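(* Let $(R,\mathfrak{m},k)$ be a Noetherian local ring of prime characteristic $p$ containing a coefficient field $k$. Let $M$ be an Artinian $R$-module which admits an injective Frobenius action $F: M\to M$. Then $M$ is $F$-stable if and only if $M_s\neq 0$.
   Context: $(R,\mathfrak{m},k)$ denotes a local ring with maximal ideal $\mathfrak m$ and residue field $k$. A coefficient field is a subfield $k\subseteq R$ such that the composition $k\hookrightarrow R\to R/\mathfrak{m}$ is an isomorphism (used to identify $k$ with $R/\mathfrak m$). A Frobenius action on an $R$-module $M$ is an additive map $F:M\to M$ with $F(rm)=r^pF(m)$ for all $r\in R$, $m\in M$; $F^e$ is its $e$-fold iterate. Let $S=\mathrm{Soc}_R(M)=\{x\in M:\mathfrak{m}x=0\}$ and $F^e(S)=\{F^e(m): m\in S\}$. $M$ is $F$-unstable if there exists $N>0$ such that $S\cap F^e(S)=0$ for all $e\ge N$ (so the zero module is $F$-unstable); $M$ is $F$-stable if it is not $F$-unstable. For $j\geq 1$ let $F^j(M)=\{F^j(m):m\in M\}$ and let $\langle F^j(M)\rangle_k$ be the $k$-vector subspace of $M$ spanned by $F^j(M)$. The stable part of $M$ is $M_s=\bigcap_{j\ge 1}\langle F^j(M)\rangle_k$. *)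

theory Defs
  imports "HOL-Algebra.Algebra"
begin

text \<open>
  The order of \<open>1\<close> in the additive group; \<open>ord\<close> is \<open>0\<close> for elements of infinite order, which
  agrees with the usual convention for characteristic zero.
\<close>

definition ring_characteristic :: "('a, 'c) ring_scheme \<Rightarrow> nat" where
  "ring_characteristic R = group.ord (add_monoid R) \<one>\<^bsub>R\<^esub>"

locale local_ring = cring R for R (structure) +
  fixes \<mm> :: "'a set"
  assumes maximal: "maximalideal \<mm> R"
    and unique_maximal: "maximalideal J R \<Longrightarrow> J = \<mm>"

definition coefficient_field :: "'a set \<Rightarrow> ('a, 'c) ring_scheme \<Rightarrow> 'a set \<Rightarrow> bool" where
  "coefficient_field K R \<mm> \<longleftrightarrow>
     subfield K R \<and> (\<lambda>x. \<mm> +>\<^bsub>R\<^esub> x) \<in> ring_iso (R\<lparr>carrier := K\<rparr>) (R Quot \<mm>)"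

definition artinian_module :: "('a, 'c) ring_scheme \<Rightarrow> ('a, 'b, 'd) module_scheme \<Rightarrow> bool" where
  "artinian_module R M \<longleftrightarrow> Module.module R M \<and>
     (\<forall>N :: nat \<Rightarrow> 'b set. (\<forall>i. submodule (N i) R M) \<and> (\<forall>i. N (Suc i) \<subseteq> N i)
        \<longrightarrow> (\<exists>n. \<forall>i\<ge>n. N i = N n))"

definition frobenius_action ::
    "nat \<Rightarrow> ('a, 'c) ring_scheme \<Rightarrow> ('a, 'b, 'd) module_scheme \<Rightarrow> ('b \<Rightarrow> 'b) \<Rightarrow> bool" where
  "frobenius_action p R M F \<longleftrightarrow>
     F \<in> hom (add_monoid M) (add_monoid M) \<and>
     (\<forall>r \<in> carrier R. \<forall>x \<in> carrier M. F (r \<odot>\<^bsub>M\<^esub> x) = (r [^]\<^bsub>R\<^esub> p) \<odot>\<^bsub>M\<^esub> F x)"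

definition socle :: "'a set \<Rightarrow> ('a, 'b, 'd) module_scheme \<Rightarrow> 'b set" where
  "socle \<mm> M = {x \<in> carrier M. \<forall>a \<in> \<mm>. a \<odot>\<^bsub>M\<^esub> x = \<zero>\<^bsub>M\<^esub>}"

definition F_unstable :: "'a set \<Rightarrow> ('a, 'b, 'd) module_scheme \<Rightarrow> ('b \<Rightarrow> 'b) \<Rightarrow> bool" where
  "F_unstable \<mm> M F \<longleftrightarrow>
     (\<exists>N>0. \<forall>e\<ge>N. socle \<mm> M \<inter> (F ^^ e) ` socle \<mm> M = {\<zero>\<^bsub>M\<^esub>})"

definition F_stable :: "'a set \<Rightarrow> ('a, 'b, 'd) module_scheme \<Rightarrow> ('b \<Rightarrow> 'b) \<Rightarrow> bool" where
  "F_stable \<mm> M F \<longleftrightarrow> \<not> F_unstable \<mm> M F"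

text \<open>
  The subspace spanned by a set \<open>A \<subseteq> carrier M\<close>, where \<open>M\<close> is viewed as a vector space over
  the subfield \<open>K\<close> of \<open>R\<close> by restricting scalars.
\<close>

definition subspace_span ::
    "'a set \<Rightarrow> ('a, 'c) ring_scheme \<Rightarrow> ('a, 'b, 'd) module_scheme \<Rightarrow> 'b set \<Rightarrow> 'b set" where
  "subspace_span K R M A = \<Inter> {V. submodule V (R\<lparr>carrier := K\<rparr>) M \<and> A \<subseteq> V}"

definition stable_part ::
    "'a set \<Rightarrow> ('a, 'c) ring_scheme \<Rightarrow> ('a, 'b, 'd) module_scheme \<Rightarrow> ('b \<Rightarrow> 'b) \<Rightarrow> 'b set" where
  "stable_part K R M F = (\<Inter>j\<in>{1..}. subspace_span K R M ((F ^^ j) ` carrier M))"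

end

theory Submission
  imports Defs
begin

text \<open>
  If \<open>M\<close> is \<open>F\<close>-stable, the decreasing subspaces \<open>{x \<in> S. F\<^sup>i x \<in> S for i \<le> e}\<close> of the socle \<open>S\<close> are
  nonzero, because \<open>F\<close> is injective, and by the descending chain condition they stabilise to an
  \<open>F\<close>-invariant subspace \<open>V \<noteq> 0\<close>; so do the nonzero spans of the \<open>F\<^sup>j(V)\<close>, whose limit lies in \<open>M\<^sub>s\<close>.

  Conversely it suffices that \<open>M\<^sub>s \<subseteq> S\<close>, because \<open>M\<^sub>s\<close> is \<open>F\<close>-invariant. As \<open>k\<close> need not be perfect, extend
  scalars to an algebraic closure \<open>L\<close>. On \<open>M' = L \<otimes>\<^sub>k M\<close> the action \<open>F' = Frob \<otimes> F\<close> may fail to be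
  injective, but no nonzero element of \<open>M\<close> is \<open>F'\<close>-nilpotent. Let \<open>a\<close> range over generators of the
  maximal ideal, and let \<open>D\<^sub>e\<close> consist of the \<open>z \<in> M'\<close> for which all \<open>a F'\<^sup>i z\<close> with \<open>i \<le> e\<close> are
  \<open>F'\<close>-nilpotent. The module \<open>M'\<close> satisfies the descending chain condition (a dual of Hilbert's basis
  theorem), so \<open>D\<^sub>e\<close> is constant for \<open>e \<ge> n\<close>. If \<open>y \<in> M\<^sub>s\<close> then, \<open>L\<close> being perfect, \<open>y = F'\<^sup>j z\<close> with
  \<open>z \<in> M'\<close> for every \<open>j\<close>; for \<open>j\<close> large a power of \<open>a\<close> killing \<open>y\<close> shows \<open>z \<in> D\<^sub>n = D\<^sub>j\<close>, so \<open>a y\<close> is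
  nilpotent, that is, \<open>a y = 0\<close>.
\<close>

subsection \<open>Descending chain conditions\<close>

definition linear_on :: "('a, 'c) ring_scheme \<Rightarrow> ('a, 'b, 'd) module_scheme \<Rightarrow> 'b set \<Rightarrow> ('b \<Rightarrow> 'b) \<Rightarrow> bool" where
  "linear_on R M U \<phi> \<longleftrightarrow> \<phi> \<in> U \<rightarrow> U \<and>
     (\<forall>x\<in>U. \<forall>y\<in>U. \<phi> (x \<oplus>\<^bsub>M\<^esub> y) = \<phi> x \<oplus>\<^bsub>M\<^esub> \<phi> y) \<and>
     (\<forall>c\<in>carrier R. \<forall>x\<in>U. \<phi> (c \<odot>\<^bsub>M\<^esub> x) = c \<odot>\<^bsub>M\<^esub> \<phi> x)"

text \<open>The operators \<open>\<Phi>\<close> stand in for a larger ring of scalars. With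
  \<open>\<Phi>\<close> empty this concerns plain submodules; over \<open>L\<close>, with
  \<open>\<Phi>\<close> the actions of generators of the maximal ideal, it replaces a chain
  condition over \<open>L \<otimes> R\<close> without forming that ring.\<close>

definition dcc_on :: "('a, 'c) ring_scheme \<Rightarrow> ('a, 'b, 'd) module_scheme \<Rightarrow> ('b \<Rightarrow> 'b) set \<Rightarrow> 'b set \<Rightarrow> bool" where
  "dcc_on R M \<Phi> U \<longleftrightarrow>
     (\<forall>N :: nat \<Rightarrow> 'b set.
        (\<forall>i. submodule (N i) R M \<and> N i \<subseteq> U \<and> (\<forall>\<phi>\<in>\<Phi>. \<phi> ` N i \<subseteq> N i)) \<and> (\<forall>i. N (Suc i) \<subseteq> N i)
        \<longrightarrow> (\<exists>n. \<forall>i\<ge>n. N i = N n))"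

lemma dcc_onD:
  fixes M :: "('a, 'b, 'd) module_scheme" and N :: "nat \<Rightarrow> 'b set"
  assumes "dcc_on R M \<Phi> U" "\<And>i. submodule (N i) R M" "\<And>i. N i \<subseteq> U"
    "\<And>i \<phi> x. \<phi> \<in> \<Phi> \<Longrightarrow> x \<in> N i \<Longrightarrow> \<phi> x \<in> N i" "\<And>i. N (Suc i) \<subseteq> N i"
  shows "\<exists>n. \<forall>i\<ge>n. N i = N n"
  using assms(1)[unfolded dcc_on_def, rule_format, of N] assms(2-) by blast

lemma dcc_on_mono:
  fixes M :: "('a, 'b, 'd) module_scheme"
  assumes "dcc_on R M \<Phi> U" "\<Phi> \<subseteq> \<Psi>" "V \<subseteq> U"
  shows "dcc_on R M \<Psi> V"
  unfolding dcc_on_def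
proof (intro allI impI)
  fix N :: "nat \<Rightarrow> 'b set"
  assume N: "(\<forall>i. submodule (N i) R M \<and> N i \<subseteq> V \<and> (\<forall>\<phi>\<in>\<Psi>. \<phi> ` N i \<subseteq> N i)) \<and> (\<forall>i. N (Suc i) \<subseteq> N i)"
  show "\<exists>n. \<forall>i\<ge>n. N i = N n"
    by (rule dcc_onD[OF assms(1)]) (use N assms(2,3) in blast)+
qed

context module begin

lemma submodule_zero: "submodule H R M \<Longrightarrow> \<zero>\<^bsub>M\<^esub> \<in> H"
  using subgroup.one_closed[OF submodule.axioms(1)] by fastforce

lemma submodule_minus:
  assumes "submodule H R M" "x \<in> H" "y \<in> H" shows "x \<ominus>\<^bsub>M\<^esub> y \<in> H"
  using submoduleE(3,5)[OF assms(1)] assms(2,3) unfolding a_minus_def by blast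

lemma submoduleI':
  assumes "H \<subseteq> carrier M" "\<zero>\<^bsub>M\<^esub> \<in> H"
    and "\<And>x y. x \<in> H \<Longrightarrow> y \<in> H \<Longrightarrow> x \<oplus>\<^bsub>M\<^esub> y \<in> H"
    and "\<And>a x. a \<in> carrier R \<Longrightarrow> x \<in> H \<Longrightarrow> a \<odot>\<^bsub>M\<^esub> x \<in> H"
  shows "submodule H R M"
proof (rule submoduleI)
  fix x assume x: "x \<in> H"
  have "\<ominus>\<^bsub>M\<^esub> x = (\<ominus> \<one>) \<odot>\<^bsub>M\<^esub> x"
    using x assms(1) by (simp add: smult_l_minus subset_iff)
  then show "\<ominus>\<^bsub>M\<^esub> x \<in> H" using assms(4) x by simp
qed (use assms in auto)

lemma linear_onD:
  assumes "linear_on R M U \<phi>"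
  shows "x \<in> U \<Longrightarrow> \<phi> x \<in> U"
    and "x \<in> U \<Longrightarrow> y \<in> U \<Longrightarrow> \<phi> (x \<oplus>\<^bsub>M\<^esub> y) = \<phi> x \<oplus>\<^bsub>M\<^esub> \<phi> y"
    and "c \<in> carrier R \<Longrightarrow> x \<in> U \<Longrightarrow> \<phi> (c \<odot>\<^bsub>M\<^esub> x) = c \<odot>\<^bsub>M\<^esub> \<phi> x"
  using assms unfolding linear_on_def by auto

lemma linear_on_zero:
  assumes "linear_on R M U \<phi>" "submodule U R M"
  shows "\<phi> \<zero>\<^bsub>M\<^esub> = \<zero>\<^bsub>M\<^esub>"
proof -
  have z: "\<zero>\<^bsub>M\<^esub> \<in> U" using assms(2) by (rule submodule_zero)
  then have "\<phi> \<zero>\<^bsub>M\<^esub> \<in> carrier M"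
    using linear_onD(1)[OF assms(1)] submoduleE(1)[OF assms(2)] by blast
  then show ?thesis using linear_onD(3)[OF assms(1) R.zero_closed z] by simp
qed

lemma linear_on_minus:
  assumes "linear_on R M U \<phi>" "submodule U R M" "x \<in> U" "y \<in> U"
  shows "\<phi> (x \<ominus>\<^bsub>M\<^esub> y) = \<phi> x \<ominus>\<^bsub>M\<^esub> \<phi> y"
proof -
  have U: "U \<subseteq> carrier M" using submoduleE(1)[OF assms(2)] .
  have c: "y \<in> carrier M" "\<phi> y \<in> carrier M" using assms(4) linear_onD(1)[OF assms(1)] U by auto
  have "\<ominus>\<^bsub>M\<^esub> y = (\<ominus> \<one>) \<odot>\<^bsub>M\<^esub> y" using c by (simp add: smult_l_minus)
  moreover have "\<ominus>\<^bsub>M\<^esub> \<phi> y = (\<ominus> \<one>) \<odot>\<^bsub>M\<^esub> \<phi> y" using c by (simp add: smult_l_minus)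
  moreover have "(\<ominus> \<one>) \<odot>\<^bsub>M\<^esub> y \<in> U" using submoduleE(4)[OF assms(2)] assms(4) by simp
  ultimately show ?thesis
    unfolding a_minus_def using linear_onD(2,3)[OF assms(1)] assms(3,4) by simp
qed

lemma linear_on_funpow:
  assumes "linear_on R M U \<phi>"
  shows "linear_on R M U (\<phi> ^^ k)"
proof (induction k)
  case 0
  show ?case by (simp add: linear_on_def)
next
  case (Suc k)
  show ?case unfolding linear_on_def
    by (auto simp: linear_onD[OF assms] linear_onD[OF Suc] Pi_iff)
qed

text \<open>
  As in Hilbert's basis theorem, a stable submodule \<open>N\<close> is recorded by its "leading terms"
  \<open>\<phi>\<^sup>k(N \<inter> ker \<phi>\<^sup>k\<^sup>+\<^sup>1) \<subseteq> ker \<phi>\<close>, which decrease in \<open>k\<close>.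
\<close>

lemma dcc_on_kernel:
  assumes U: "submodule U R M"
    and lin: "\<And>\<psi>. \<psi> \<in> \<Phi> \<Longrightarrow> linear_on R M U \<psi>"
    and \<phi>: "\<phi> \<in> \<Phi>"
    and comm: "\<And>\<psi> x. \<psi> \<in> \<Phi> \<Longrightarrow> x \<in> U \<Longrightarrow> \<psi> (\<phi> x) = \<phi> (\<psi> x)"
    and nil: "\<And>x. x \<in> U \<Longrightarrow> \<exists>k. (\<phi> ^^ k) x = \<zero>\<^bsub>M\<^esub>"
    and ker: "dcc_on R M \<Phi> {x \<in> U. \<phi> x = \<zero>\<^bsub>M\<^esub>}"
  shows "dcc_on R M \<Phi> U"
  unfolding dcc_on_def
proof (intro allI impI, elim conjE)
  fix N :: "nat \<Rightarrow> 'c set"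
  assume "\<forall>i. submodule (N i) R M \<and> N i \<subseteq> U \<and> (\<forall>\<phi>\<in>\<Phi>. \<phi> ` N i \<subseteq> N i)" and dec: "\<forall>i. N (Suc i) \<subseteq> N i"
  then have sub: "\<And>i. submodule (N i) R M" and NU: "\<And>i. N i \<subseteq> U"
    and stab: "\<And>i \<psi> x. \<psi> \<in> \<Phi> \<Longrightarrow> x \<in> N i \<Longrightarrow> \<psi> x \<in> N i" by blast+
  have mono: "N j \<subseteq> N i" if "i \<le> j" for i j
    using lift_Suc_antimono_le[of N, OF _ that] dec by blast
  have U0: "\<zero>\<^bsub>M\<^esub> \<in> U" and UM: "U \<subseteq> carrier M" using submodule_zero[OF U] submoduleE(1)[OF U] by auto
  note \<phi>D = linear_onD[OF lin[OF \<phi>]]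
  have pw: "linear_on R M U (\<phi> ^^ k)" for k by (rule linear_on_funpow[OF lin[OF \<phi>]])
  note pwD = linear_onD[OF pw]
  have comm_pow: "\<psi> ((\<phi> ^^ k) x) = (\<phi> ^^ k) (\<psi> x)" if "\<psi> \<in> \<Phi>" "x \<in> U" for \<psi> k x
    using that by (induction k) (simp_all add: comm pwD)
  have powN: "(\<phi> ^^ k) x \<in> N i" if "x \<in> N i" for k x i
    using that by (induction k) (simp_all add: stab[OF \<phi>])
  define A where "A i k = {w. \<exists>z\<in>N i. w = (\<phi> ^^ k) z \<and> \<phi> w = \<zero>\<^bsub>M\<^esub>}" for i k
  have AI: "(\<phi> ^^ k) z \<in> A i k" if "z \<in> N i" "\<phi> ((\<phi> ^^ k) z) = \<zero>\<^bsub>M\<^esub>" for z i k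
    using that unfolding A_def by blast
  have AE: "\<exists>z\<in>N i. w = (\<phi> ^^ k) z \<and> \<phi> w = \<zero>\<^bsub>M\<^esub>" if "w \<in> A i k" for w i k
    using that unfolding A_def by blast
  have A_ker: "A i k \<subseteq> {x \<in> U. \<phi> x = \<zero>\<^bsub>M\<^esub>}" for i k
    using NU pwD(1) unfolding A_def by blast
  have A_sub: "submodule (A i k) R M" for i k
  proof (rule submoduleI')
    show "A i k \<subseteq> carrier M" using A_ker UM by blast
    show "\<zero>\<^bsub>M\<^esub> \<in> A i k"
      using AI[of "\<zero>\<^bsub>M\<^esub>" i k] submodule_zero[OF sub] linear_on_zero[OF pw U] linear_on_zero[OF lin[OF \<phi>] U]
      by simp
  next
    fix x y assume "x \<in> A i k" "y \<in> A i k"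
    then obtain z z' where z: "z \<in> N i" "x = (\<phi> ^^ k) z" "\<phi> x = \<zero>\<^bsub>M\<^esub>" "z' \<in> N i" "y = (\<phi> ^^ k) z'" "\<phi> y = \<zero>\<^bsub>M\<^esub>"
      using AE by blast
    have zU: "z \<in> U" "z' \<in> U" "x \<in> U" "y \<in> U" using z NU pwD(1) by blast+
    have "z \<oplus>\<^bsub>M\<^esub> z' \<in> N i" using submoduleE(5)[OF sub] z by blast
    moreover have "(\<phi> ^^ k) (z \<oplus>\<^bsub>M\<^esub> z') = x \<oplus>\<^bsub>M\<^esub> y" using pwD(2) zU z by simp
    moreover have "\<phi> (x \<oplus>\<^bsub>M\<^esub> y) = \<zero>\<^bsub>M\<^esub>" using \<phi>D(2) zU z by simp
    ultimately show "x \<oplus>\<^bsub>M\<^esub> y \<in> A i k" using AI by metis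
  next
    fix a x assume a: "a \<in> carrier R" "x \<in> A i k"
    then obtain z where z: "z \<in> N i" "x = (\<phi> ^^ k) z" "\<phi> x = \<zero>\<^bsub>M\<^esub>"
      using AE by blast
    have zU: "z \<in> U" "x \<in> U" using z NU pwD(1) by blast+
    have "a \<odot>\<^bsub>M\<^esub> z \<in> N i" using submoduleE(4)[OF sub] z a by blast
    moreover have "(\<phi> ^^ k) (a \<odot>\<^bsub>M\<^esub> z) = a \<odot>\<^bsub>M\<^esub> x" using pwD(3) zU z a by simp
    moreover have "\<phi> (a \<odot>\<^bsub>M\<^esub> x) = \<zero>\<^bsub>M\<^esub>" using \<phi>D(3) zU z a by simp
    ultimately show "a \<odot>\<^bsub>M\<^esub> x \<in> A i k" using AI by metis
  qed
  have A_stab: "\<psi> x \<in> A i k" if \<psi>: "\<psi> \<in> \<Phi>" and x: "x \<in> A i k" for \<psi> x i k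
  proof -
    obtain z where z: "z \<in> N i" "x = (\<phi> ^^ k) z" "\<phi> x = \<zero>\<^bsub>M\<^esub>" using AE[OF x] by blast
    have zU: "z \<in> U" "x \<in> U" using z NU pwD(1) by blast+
    have "\<psi> x = (\<phi> ^^ k) (\<psi> z)" using comm_pow[OF \<psi> zU(1)] z by simp
    moreover have "\<phi> (\<psi> x) = \<zero>\<^bsub>M\<^esub>" using comm[OF \<psi> zU(2)] z linear_on_zero[OF lin[OF \<psi>] U] by simp
    ultimately show ?thesis using AI[OF stab[OF \<psi> z(1)]] by metis
  qed
  have A_dec1: "A j k \<subseteq> A i k" if "i \<le> j" for i j k
    using mono[OF that] unfolding A_def by blast
  have A_dec2: "A i (Suc k) \<subseteq> A i k" for i k
  proof
    fix w assume "w \<in> A i (Suc k)"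
    then obtain z where "z \<in> N i" "w = (\<phi> ^^ Suc k) z" "\<phi> w = \<zero>\<^bsub>M\<^esub>" using AE by blast
    moreover from this have "w = (\<phi> ^^ k) (\<phi> z)" by (metis comp_apply funpow_Suc_right)
    ultimately show "w \<in> A i k" using AI stab[OF \<phi>] by metis
  qed
  have A_dec2': "A i l \<subseteq> A i k" if "k \<le> l" for i k l
    using lift_Suc_antimono_le[of "A i", OF A_dec2 that] .
  \<comment> \<open>The family decreases in both indices, so stability of the diagonal makes
    \<open>A i k\<close> constant once both indices reach \<open>n0\<close>.\<close>
  have "\<exists>n. \<forall>i\<ge>n. A i i = A n n"
    by (rule dcc_onD[OF ker, of "\<lambda>i. A i i"])
      (use A_sub A_ker A_stab in \<open>auto intro: subsetD[OF A_dec1[OF le_SucI[OF order_refl]]] subsetD[OF A_dec2]\<close>)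
  then obtain n0 where n0: "\<And>i. i \<ge> n0 \<Longrightarrow> A i i = A n0 n0" by blast
  have large: "A i k = A n0 n0" if "i \<ge> n0" "k \<ge> n0" for i k
  proof
    show "A i k \<subseteq> A n0 n0" using A_dec1[OF that(1)] A_dec2'[OF that(2)] by blast
    have "A (max i k) (max i k) \<subseteq> A i k" using A_dec1[of i "max i k"] A_dec2'[of k "max i k"] by force
    then show "A n0 n0 \<subseteq> A i k" using n0[of "max i k"] that by auto
  qed
  \<comment> \<open>Small \<open>k\<close> escape the diagonal argument. Each such column stabilises
    by itself, and only the finitely many with \<open>k \<le> n0\<close> have to be
    considered.\<close>
  have "\<exists>n. \<forall>i\<ge>n. A i k = A n k" for k
    by (rule dcc_onD[OF ker, of "\<lambda>i. A i k"]) (use A_sub A_ker A_stab A_dec1 in auto)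
  then obtain \<nu> where \<nu>: "\<And>k i. i \<ge> \<nu> k \<Longrightarrow> A i k = A (\<nu> k) k" by metis
  define n where "n = Max (insert n0 (\<nu> ` {..n0}))"
  have n: "n0 \<le> n" "\<And>k. k \<le> n0 \<Longrightarrow> \<nu> k \<le> n" unfolding n_def by (rule Max_ge; simp)+
  have An: "A i k = A n k" if "i \<ge> n" for i k
  proof (cases "k \<le> n0")
    case True
    then show ?thesis using \<nu> n(2) that by (metis order_trans)
  next
    case False
    then show ?thesis using large n(1) that by (metis nle_le order_trans)
  qed
  \<comment> \<open>Equal leading terms force equal modules, by induction on the exponent of
    \<open>\<phi>\<close> that kills \<open>z\<close>: subtracting an element \<open>z'\<close> of
    \<open>N i\<close> with the same leading term lowers that exponent by one.\<close>
  have "N n \<subseteq> N i" if i: "i \<ge> n" for i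
  proof
    fix z assume "z \<in> N n"
    moreover obtain k where "(\<phi> ^^ k) z = \<zero>\<^bsub>M\<^esub>" using nil NU \<open>z \<in> N n\<close> by blast
    ultimately show "z \<in> N i"
    proof (induction k arbitrary: z)
      case 0
      then show ?case using submodule_zero[OF sub] by simp
    next
      case (Suc k)
      then have "(\<phi> ^^ k) z \<in> A i k" using An[OF i] AI by simp
      then obtain z' where z': "z' \<in> N i" "(\<phi> ^^ k) z = (\<phi> ^^ k) z'" using AE by blast
      have inU: "z \<in> U" "z' \<in> U" using Suc z' NU by blast+
      then have car: "z \<in> carrier M" "z' \<in> carrier M" "(\<phi> ^^ k) z' \<in> carrier M" using UM pwD(1) by blast+
      have "z \<ominus>\<^bsub>M\<^esub> z' \<in> N n" using submodule_minus[OF sub] Suc.prems(1) z'(1) mono[OF i] by blast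
      moreover have "(\<phi> ^^ k) (z \<ominus>\<^bsub>M\<^esub> z') = \<zero>\<^bsub>M\<^esub>"
        using linear_on_minus[OF pw U inU] z'(2) car by (simp add: M.r_neg a_minus_def)
      ultimately have "z \<ominus>\<^bsub>M\<^esub> z' \<in> N i" by (rule Suc.IH)
      then have "(z \<ominus>\<^bsub>M\<^esub> z') \<oplus>\<^bsub>M\<^esub> z' \<in> N i" using submoduleE(5)[OF sub] z'(1) by blast
      then show ?case using car by (simp add: a_minus_def M.a_assoc M.l_neg)
    qed
  qed
  then have "\<forall>i\<ge>n. N i = N n" using mono by blast
  then show "\<exists>n. \<forall>i\<ge>n. N i = N n" ..
qed

section \<open>Chain conditions on finite-dimensional spaces\<close>

lemma dcc_on_zero: "dcc_on R M \<Phi> {\<zero>\<^bsub>M\<^esub>}"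
  unfolding dcc_on_def
proof (intro allI impI, elim conjE)
  fix N :: "nat \<Rightarrow> 'c set"
  assume "\<forall>i. submodule (N i) R M \<and> N i \<subseteq> {\<zero>\<^bsub>M\<^esub>} \<and> (\<forall>\<phi>\<in>\<Phi>. \<phi> ` N i \<subseteq> N i)"
  then have "N i = {\<zero>\<^bsub>M\<^esub>}" for i using submodule_zero[of "N i"] by blast
  then show "\<exists>n. \<forall>i\<ge>n. N i = N n" by simp
qed

text \<open>A chain in \<open>U + R u\<close> either eventually lies in \<open>U\<close>, or each
  member contains some \<open>v + u\<close> with \<open>v\<close> in \<open>U\<close>; in the second
  case a member of the chain is determined by its intersection with \<open>U\<close>. This is the
  inductive step for finite spans.\<close>

lemma dcc_on_line:
  assumes R: "field R" and U: "submodule U R M" and u: "u \<in> carrier M" and dcc: "dcc_on R M {} U"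
  shows "submodule {v \<oplus>\<^bsub>M\<^esub> c \<odot>\<^bsub>M\<^esub> u | v c. v \<in> U \<and> c \<in> carrier R} R M" (is "submodule ?V R M")
    and "dcc_on R M {} {v \<oplus>\<^bsub>M\<^esub> c \<odot>\<^bsub>M\<^esub> u | v c. v \<in> U \<and> c \<in> carrier R}"
proof -
  interpret R: field R by (rule R)
  have UM: "U \<subseteq> carrier M" by (rule submoduleE(1)[OF U])
  show "submodule ?V R M"
  proof (rule submoduleI')
    show "?V \<subseteq> carrier M" using UM u by auto
    have "\<zero>\<^bsub>M\<^esub> = \<zero>\<^bsub>M\<^esub> \<oplus>\<^bsub>M\<^esub> \<zero> \<odot>\<^bsub>M\<^esub> u" using u by simp
    then show "\<zero>\<^bsub>M\<^esub> \<in> ?V" using submodule_zero[OF U] by blast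
  next
    fix x y assume "x \<in> ?V" "y \<in> ?V"
    then obtain v c w d where *: "x = v \<oplus>\<^bsub>M\<^esub> c \<odot>\<^bsub>M\<^esub> u" "y = w \<oplus>\<^bsub>M\<^esub> d \<odot>\<^bsub>M\<^esub> u"
      "v \<in> U" "w \<in> U" "c \<in> carrier R" "d \<in> carrier R" by blast
    then have "x \<oplus>\<^bsub>M\<^esub> y = (v \<oplus>\<^bsub>M\<^esub> w) \<oplus>\<^bsub>M\<^esub> (c \<oplus> d) \<odot>\<^bsub>M\<^esub> u"
      using UM u by (simp add: subset_iff smult_l_distr M.add.m_ac)
    then show "x \<oplus>\<^bsub>M\<^esub> y \<in> ?V" using * submoduleE(5)[OF U] by blast
  next
    fix a x assume a: "a \<in> carrier R" and "x \<in> ?V"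
    then obtain v c where *: "x = v \<oplus>\<^bsub>M\<^esub> c \<odot>\<^bsub>M\<^esub> u" "v \<in> U" "c \<in> carrier R" by blast
    then have "a \<odot>\<^bsub>M\<^esub> x = a \<odot>\<^bsub>M\<^esub> v \<oplus>\<^bsub>M\<^esub> (a \<otimes> c) \<odot>\<^bsub>M\<^esub> u"
      using UM u a by (simp add: subset_iff smult_r_distr smult_assoc1)
    then show "a \<odot>\<^bsub>M\<^esub> x \<in> ?V" using * submoduleE(4)[OF U a] R.m_closed[OF a] by blast
  qed
  show "dcc_on R M {} ?V"
    unfolding dcc_on_def
  proof (intro allI impI, elim conjE)
    fix N :: "nat \<Rightarrow> 'c set"
    assume *: "\<forall>i. submodule (N i) R M \<and> N i \<subseteq> ?V \<and> (\<forall>\<phi>\<in>{}. \<phi> ` N i \<subseteq> N i)" and dec: "\<forall>i. N (Suc i) \<subseteq> N i"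
    have sub: "\<And>i. submodule (N i) R M" and NV: "\<And>i. N i \<subseteq> ?V" using * by blast+
    have mono: "N j \<subseteq> N i" if "i \<le> j" for i j
      using lift_Suc_antimono_le[of N, OF _ that] dec by blast
    have NM: "N i \<subseteq> carrier M" for i by (rule submoduleE(1)[OF sub])
    have subUN: "submodule (N i \<inter> U) R M" for i
      by (rule submoduleI') (use UM submodule_zero[OF U] submodule_zero[OF sub] submoduleE(4,5)[OF U] submoduleE(4,5)[OF sub] in auto)
    have "\<exists>n. \<forall>i\<ge>n. N i \<inter> U = N n \<inter> U"
      by (rule dcc_onD[OF dcc, of "\<lambda>i. N i \<inter> U"]) (use dec subUN in auto)
    then obtain n1 where n1: "\<And>i. i \<ge> n1 \<Longrightarrow> N i \<inter> U = N n1 \<inter> U" by blast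
    show "\<exists>n. \<forall>i\<ge>n. N i = N n"
    proof (cases "\<exists>i. N i \<subseteq> U")
      case True
      then obtain i0 where "N i0 \<subseteq> U" by blast
      then have "N i = N i \<inter> U" if "i \<ge> i0" for i using mono[OF that] by blast
      then have "N i = N (max i0 n1)" if "i \<ge> max i0 n1" for i
        using n1 that by (metis max.bounded_iff max.cobounded1 max.cobounded2)
      then show ?thesis by blast
    next
      case False
      have ex: "\<exists>v\<in>U. v \<oplus>\<^bsub>M\<^esub> u \<in> N i" for i
      proof -
        obtain x where x: "x \<in> N i" "x \<notin> U" using False by blast
        then obtain v c where vc: "x = v \<oplus>\<^bsub>M\<^esub> c \<odot>\<^bsub>M\<^esub> u" "v \<in> U" "c \<in> carrier R" using NV by blast
        have "c \<noteq> \<zero>" using vc x u UM by auto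
        then have inv: "inv c \<in> carrier R" "inv c \<otimes> c = \<one>" using vc(3) R.field_Units by (simp_all add: R.field_Units)
        have "inv c \<odot>\<^bsub>M\<^esub> x = inv c \<odot>\<^bsub>M\<^esub> v \<oplus>\<^bsub>M\<^esub> u"
          using vc inv u UM by (simp add: subset_iff smult_r_distr smult_assoc1[symmetric])
        moreover have "inv c \<odot>\<^bsub>M\<^esub> x \<in> N i" using submoduleE(4)[OF sub inv(1) x(1)] .
        ultimately show ?thesis using submoduleE(4)[OF U inv(1) vc(2)] by auto
      qed
      \<comment> \<open>From \<open>v + c u\<close> in \<open>N n1\<close> subtract the element
        \<open>c (w + u)\<close> of \<open>N i\<close>: the difference lies in \<open>U\<close> and
        in \<open>N n1\<close>, hence in \<open>N i\<close>.\<close>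
      have "N n1 \<subseteq> N i" if i: "i \<ge> n1" for i
      proof
        fix x assume x: "x \<in> N n1"
        then obtain v c where vc: "x = v \<oplus>\<^bsub>M\<^esub> c \<odot>\<^bsub>M\<^esub> u" "v \<in> U" "c \<in> carrier R" using NV by blast
        obtain w where w: "w \<in> U" "w \<oplus>\<^bsub>M\<^esub> u \<in> N i" using ex by blast
        let ?y = "c \<odot>\<^bsub>M\<^esub> (w \<oplus>\<^bsub>M\<^esub> u)"
        have y: "?y \<in> N i" using submoduleE(4)[OF sub vc(3) w(2)] .
        have car: "v \<in> carrier M" "w \<in> carrier M" "x \<in> carrier M" using vc w UM x NM by blast+
        have "x \<ominus>\<^bsub>M\<^esub> ?y = v \<ominus>\<^bsub>M\<^esub> c \<odot>\<^bsub>M\<^esub> w"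
          using vc(1,3) car u
          by (simp add: smult_r_distr a_minus_def M.minus_add M.add.m_ac)
             (simp add: M.add.m_assoc[symmetric] M.r_neg)
        moreover have "v \<ominus>\<^bsub>M\<^esub> c \<odot>\<^bsub>M\<^esub> w \<in> U"
          using submodule_minus[OF U] vc submoduleE(4)[OF U vc(3) w(1)] by blast
        moreover have "x \<ominus>\<^bsub>M\<^esub> ?y \<in> N n1" using submodule_minus[OF sub x] y mono[OF i] by blast
        ultimately have "x \<ominus>\<^bsub>M\<^esub> ?y \<in> N i" using n1[OF i] by auto
        then have "(x \<ominus>\<^bsub>M\<^esub> ?y) \<oplus>\<^bsub>M\<^esub> ?y \<in> N i" using submoduleE(5)[OF sub] y by blast
        moreover have "?y \<in> carrier M" using y NM by blast
        ultimately show "x \<in> N i" using car(3) by (simp add: a_minus_def M.a_assoc M.l_neg)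
      qed
      then have "\<forall>i\<ge>n1. N i = N n1" using mono by blast
      then show ?thesis ..
    qed
  qed
qed

lemma dcc_on_finite_span:
  assumes "field R" "finite A" "A \<subseteq> carrier M"
  shows "\<exists>U. submodule U R M \<and> A \<subseteq> U \<and> dcc_on R M {} U"
  using assms(2,3)
proof (induction rule: finite_induct)
  case empty
  have "submodule {\<zero>\<^bsub>M\<^esub>} R M" by (rule submoduleI') auto
  then show ?case using dcc_on_zero by blast
next
  case (insert u A)
  then obtain U where U: "submodule U R M" "A \<subseteq> U" "dcc_on R M {} U" by auto
  let ?V = "{v \<oplus>\<^bsub>M\<^esub> c \<odot>\<^bsub>M\<^esub> u | v c. v \<in> U \<and> c \<in> carrier R}"
  have u: "u \<in> carrier M" using insert by blast
  have "u = \<zero>\<^bsub>M\<^esub> \<oplus>\<^bsub>M\<^esub> \<one> \<odot>\<^bsub>M\<^esub> u" using u by simp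
  then have "u \<in> ?V" using submodule_zero[OF U(1)] by blast
  moreover have "U \<subseteq> ?V"
  proof
    fix v assume "v \<in> U"
    moreover from this have "v = v \<oplus>\<^bsub>M\<^esub> \<zero> \<odot>\<^bsub>M\<^esub> u" using u submoduleE(1)[OF U(1)] by auto
    ultimately show "v \<in> ?V" by blast
  qed
  ultimately show ?case using dcc_on_line[OF assms(1) U(1) u U(3)] U(2) by blast
qed

end

subsection \<open>Linear functionals over a subfield\<close>

lemma (in module) module_restrict:
  assumes "subfield K R"
  shows "module (R\<lparr>carrier := K\<rparr>) M"
proof -
  have "subring K R" by (rule subfieldE(1)[OF assms])
  then have "cring (R\<lparr>carrier := K\<rparr>)" using R.subcring_iff R.subcringI' subringE(1) by blast
  moreover have "K \<subseteq> carrier R" by (rule subfieldE(3)[OF assms])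
  ultimately show ?thesis
    by (intro moduleI) (auto simp: smult_l_distr smult_r_distr smult_assoc1 subset_iff M.abelian_group_axioms)
qed

text \<open>The dual space of \<open>M\<close> over \<open>K\<close>, with values kept inside
  \<open>R\<close>. Values off \<open>carrier M\<close> are unconstrained, so one functional can
  have many representatives.\<close>

definition functionals :: "'a set \<Rightarrow> ('a, 'c) ring_scheme \<Rightarrow> ('a, 'b, 'd) module_scheme \<Rightarrow> ('b \<Rightarrow> 'a) set" where
  "functionals K R M = {f \<in> carrier M \<rightarrow> K.
     (\<forall>x\<in>carrier M. \<forall>y\<in>carrier M. f (x \<oplus>\<^bsub>M\<^esub> y) = f x \<oplus>\<^bsub>R\<^esub> f y) \<and>
     (\<forall>c\<in>K. \<forall>x\<in>carrier M. f (c \<odot>\<^bsub>M\<^esub> x) = c \<otimes>\<^bsub>R\<^esub> f x)}"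

lemma functionalsD:
  assumes "f \<in> functionals K R M"
  shows "x \<in> carrier M \<Longrightarrow> f x \<in> K"
    and "x \<in> carrier M \<Longrightarrow> y \<in> carrier M \<Longrightarrow> f (x \<oplus>\<^bsub>M\<^esub> y) = f x \<oplus>\<^bsub>R\<^esub> f y"
    and "c \<in> K \<Longrightarrow> x \<in> carrier M \<Longrightarrow> f (c \<odot>\<^bsub>M\<^esub> x) = c \<otimes>\<^bsub>R\<^esub> f x"
  using assms unfolding functionals_def by auto

text \<open>By Zorn's lemma some subspace \<open>H\<close> is maximal among those avoiding
  \<open>x\<close>. Maximality makes it a complement of the line \<open>K x\<close>, and the
  functional reads off the coefficient of \<open>x\<close>.\<close>

lemma (in module) ex_functional:
  assumes K: "subfield K R" and x: "x \<in> carrier M" "x \<noteq> \<zero>\<^bsub>M\<^esub>"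
  shows "\<exists>f\<in>functionals K R M. f x = \<one>"
proof -
  interpret KF: field "R\<lparr>carrier := K\<rparr>" using R.subfield_iff(2)[OF K] .
  interpret N: module "R\<lparr>carrier := K\<rparr>" M by (rule module_restrict[OF K])
  have KR: "K \<subseteq> carrier R" by (rule subfieldE(3)[OF K])
  define \<H> where "\<H> = {H. submodule H (R\<lparr>carrier := K\<rparr>) M \<and> x \<notin> H}"
  have zero: "submodule {\<zero>\<^bsub>M\<^esub>} (R\<lparr>carrier := K\<rparr>) M"
    by (rule N.submoduleI') (use KR in auto)
  have "\<exists>H\<in>\<H>. \<forall>H'\<in>\<H>. H \<subseteq> H' \<longrightarrow> H' = H"
  proof (rule subset_Zorn_nonempty)
    show "\<H> \<noteq> {}" using zero x unfolding \<H>_def by blast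
  next
    fix C assume C: "C \<noteq> {}" "subset.chain \<H> C"
    have sub: "submodule H (R\<lparr>carrier := K\<rparr>) M" "x \<notin> H" if "H \<in> C" for H
      using that C(2) unfolding \<H>_def subset.chain_def by blast+
    have "submodule (\<Union>C) (R\<lparr>carrier := K\<rparr>) M"
    proof (rule N.submoduleI')
      show "\<Union>C \<subseteq> carrier M" using N.submoduleE(1)[OF sub(1)] by blast
      show "\<zero>\<^bsub>M\<^esub> \<in> \<Union>C" using C(1) N.submodule_zero[OF sub(1)] by blast
    next
      fix u v assume "u \<in> \<Union>C" "v \<in> \<Union>C"
      then obtain H H' where H: "H \<in> C" "u \<in> H" "H' \<in> C" "v \<in> H'" by blast
      then have "H \<subseteq> H' \<or> H' \<subseteq> H" using C(2) unfolding subset.chain_def by blast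
      then show "u \<oplus>\<^bsub>M\<^esub> v \<in> \<Union>C" using N.submoduleE(5)[OF sub(1)] H by blast
    next
      fix a u assume "a \<in> carrier (R\<lparr>carrier := K\<rparr>)" "u \<in> \<Union>C"
      then show "a \<odot>\<^bsub>M\<^esub> u \<in> \<Union>C" using N.submoduleE(4)[OF sub(1)] by blast
    qed
    then show "\<Union>C \<in> \<H>" using sub(2) unfolding \<H>_def by blast
  qed
  then obtain H where H: "submodule H (R\<lparr>carrier := K\<rparr>) M" "x \<notin> H"
    and max: "\<And>H'. submodule H' (R\<lparr>carrier := K\<rparr>) M \<Longrightarrow> x \<notin> H' \<Longrightarrow> H \<subseteq> H' \<Longrightarrow> H' = H"
    unfolding \<H>_def by blast
  note HE = N.submoduleE[OF H(1), simplified]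
  \<comment> \<open>If \<open>m\<close> is outside \<open>H\<close>, then \<open>H + K m\<close>
    must contain \<open>x\<close>; the coefficient of \<open>m\<close> there is nonzero because
    \<open>x\<close> is not in \<open>H\<close>, so the relation can be solved for
    \<open>m\<close>.\<close>
  have ex: "\<exists>c\<in>K. \<exists>u\<in>H. m = u \<oplus>\<^bsub>M\<^esub> c \<odot>\<^bsub>M\<^esub> x" if m: "m \<in> carrier M" for m
  proof (cases "m \<in> H")
    case True
    moreover have "m = m \<oplus>\<^bsub>M\<^esub> \<zero> \<odot>\<^bsub>M\<^esub> x" using m x by simp
    moreover have "\<zero> \<in> K" using KF.zero_closed by simp
    ultimately show ?thesis by blast
  next
    case False
    define H' where "H' = {u \<oplus>\<^bsub>M\<^esub> c \<odot>\<^bsub>M\<^esub> m | u c. u \<in> H \<and> c \<in> K}"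
    have "submodule H' (R\<lparr>carrier := K\<rparr>) M"
    proof (rule N.submoduleI')
      show "H' \<subseteq> carrier M" using HE(1) m KR unfolding H'_def by auto
      have "\<zero>\<^bsub>M\<^esub> = \<zero>\<^bsub>M\<^esub> \<oplus>\<^bsub>M\<^esub> \<zero> \<odot>\<^bsub>M\<^esub> m" using m by simp
      then show "\<zero>\<^bsub>M\<^esub> \<in> H'" unfolding H'_def using N.submodule_zero[OF H(1)] KF.zero_closed by fastforce
    next
      fix u v assume "u \<in> H'" "v \<in> H'"
      then obtain u1 v1 c d where *: "u = u1 \<oplus>\<^bsub>M\<^esub> c \<odot>\<^bsub>M\<^esub> m" "v = v1 \<oplus>\<^bsub>M\<^esub> d \<odot>\<^bsub>M\<^esub> m"
        "u1 \<in> H" "v1 \<in> H" "c \<in> K" "d \<in> K" unfolding H'_def by blast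
      then have "u \<oplus>\<^bsub>M\<^esub> v = (u1 \<oplus>\<^bsub>M\<^esub> v1) \<oplus>\<^bsub>M\<^esub> (c \<oplus> d) \<odot>\<^bsub>M\<^esub> m"
        using HE(1) KR m by (simp add: subset_iff smult_l_distr M.add.m_ac)
      then show "u \<oplus>\<^bsub>M\<^esub> v \<in> H'" unfolding H'_def using * HE(5) KF.add.m_closed by fastforce
    next
      fix a u assume a: "a \<in> carrier (R\<lparr>carrier := K\<rparr>)" and "u \<in> H'"
      then obtain v c where *: "u = v \<oplus>\<^bsub>M\<^esub> c \<odot>\<^bsub>M\<^esub> m" "v \<in> H" "c \<in> K" unfolding H'_def by blast
      then have "a \<odot>\<^bsub>M\<^esub> u = a \<odot>\<^bsub>M\<^esub> v \<oplus>\<^bsub>M\<^esub> (a \<otimes> c) \<odot>\<^bsub>M\<^esub> m"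
        using HE(1) KR m a by (simp add: subset_iff smult_r_distr smult_assoc1)
      then show "a \<odot>\<^bsub>M\<^esub> u \<in> H'" unfolding H'_def using * HE(4) a KF.m_closed[of a c] by fastforce
    qed
    moreover have "H \<subseteq> H'"
    proof
      fix u assume u: "u \<in> H"
      then have "u = u \<oplus>\<^bsub>M\<^esub> \<zero> \<odot>\<^bsub>M\<^esub> m" using HE(1) m by auto
      then show "u \<in> H'" unfolding H'_def using u KF.zero_closed by fastforce
    qed
    moreover have "m \<in> H'"
    proof -
      have "m = \<zero>\<^bsub>M\<^esub> \<oplus>\<^bsub>M\<^esub> \<one> \<odot>\<^bsub>M\<^esub> m" using m by simp
      then show ?thesis unfolding H'_def using N.submodule_zero[OF H(1)] KF.one_closed by fastforce
    qed
    ultimately have "x \<in> H'" using max False by blast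
    then obtain u c where uc: "x = u \<oplus>\<^bsub>M\<^esub> c \<odot>\<^bsub>M\<^esub> m" "u \<in> H" "c \<in> K" unfolding H'_def by blast
    have uM: "u \<in> carrier M" using uc HE(1) by blast
    have "c \<noteq> \<zero>" using uc H(2) m uM by auto
    then obtain d where d: "d \<in> K" "d \<otimes> c = \<one>"
      using KF.field_Units uc(3) unfolding Units_def by auto
    have dR: "d \<in> carrier R" "c \<in> carrier R" using d uc KR by blast+
    have "d \<odot>\<^bsub>M\<^esub> x = d \<odot>\<^bsub>M\<^esub> u \<oplus>\<^bsub>M\<^esub> m"
      using uc(1) dR d(2) m uM by (simp add: smult_r_distr smult_assoc1[symmetric])
    then have "m = \<ominus>\<^bsub>M\<^esub> (d \<odot>\<^bsub>M\<^esub> u) \<oplus>\<^bsub>M\<^esub> d \<odot>\<^bsub>M\<^esub> x"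
      using dR uM m by (simp add: M.r_neg1 M.r_neg2)
    moreover have "\<ominus>\<^bsub>M\<^esub> (d \<odot>\<^bsub>M\<^esub> u) \<in> H" using HE(3,4) d uc by blast
    ultimately show ?thesis using d(1) by blast
  qed
  have uniq: "c = d" if "c \<in> K" "d \<in> K" "u \<in> H" "v \<in> H"
    and eq: "u \<oplus>\<^bsub>M\<^esub> c \<odot>\<^bsub>M\<^esub> x = v \<oplus>\<^bsub>M\<^esub> d \<odot>\<^bsub>M\<^esub> x" for c d u v
  proof (rule ccontr)
    assume ne: "c \<noteq> d"
    have R: "c \<in> carrier R" "d \<in> carrier R" using that KR by blast+
    have uM: "u \<in> carrier M" "v \<in> carrier M" using that HE(1) by blast+
    have cd: "c \<ominus> d \<in> K"
      using subringE(5,7)[OF subfieldE(1)[OF K]] that(1,2) unfolding a_minus_def by blast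
    moreover have cd0: "c \<ominus> d \<noteq> \<zero>" using ne R by simp
    ultimately obtain e where e: "e \<in> K" "e \<otimes> (c \<ominus> d) = \<one>"
      using KF.field_Units unfolding Units_def by auto
    have eR: "e \<in> carrier R" using e KR by blast
    have "(c \<ominus> d) \<odot>\<^bsub>M\<^esub> x = v \<ominus>\<^bsub>M\<^esub> u"
    proof -
      have "c \<odot>\<^bsub>M\<^esub> x = \<ominus>\<^bsub>M\<^esub> u \<oplus>\<^bsub>M\<^esub> (v \<oplus>\<^bsub>M\<^esub> d \<odot>\<^bsub>M\<^esub> x)"
        using eq[symmetric] uM R x by (simp add: M.r_neg1 M.r_neg2)
      then show ?thesis using uM R x
        by (simp add: a_minus_def smult_l_distr smult_l_minus M.add.m_ac M.r_neg)
    qed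
    then have "(c \<ominus> d) \<odot>\<^bsub>M\<^esub> x \<in> H" using N.submodule_minus[OF H(1)] that by simp
    then have "e \<odot>\<^bsub>M\<^esub> ((c \<ominus> d) \<odot>\<^bsub>M\<^esub> x) \<in> H" using HE(4) e by simp
    moreover have "e \<odot>\<^bsub>M\<^esub> ((c \<ominus> d) \<odot>\<^bsub>M\<^esub> x) = x"
      using smult_assoc1[OF eR _ x(1), of "c \<ominus> d", symmetric] e(2) R x by simp
    ultimately show False using H(2) by simp
  qed
  \<comment> \<open>The coefficient is first introduced as a relation, so that linearity of
    \<open>f\<close> follows from uniqueness.\<close>
  define P where "P m c \<longleftrightarrow> c \<in> K \<and> (\<exists>u\<in>H. m = u \<oplus>\<^bsub>M\<^esub> c \<odot>\<^bsub>M\<^esub> x)" for m c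
  have P_ex: "\<exists>c. P m c" if "m \<in> carrier M" for m using ex[OF that] unfolding P_def by blast
  have P_uniq: "c = d" if "P m c" "P m d" for m c d
    using that uniq unfolding P_def by blast
  have P_add: "P (m \<oplus>\<^bsub>M\<^esub> n) (c \<oplus> d)" if "P m c" "P n d" for m n c d
  proof -
    obtain u v where uv: "u \<in> H" "m = u \<oplus>\<^bsub>M\<^esub> c \<odot>\<^bsub>M\<^esub> x" "v \<in> H" "n = v \<oplus>\<^bsub>M\<^esub> d \<odot>\<^bsub>M\<^esub> x"
      and K': "c \<in> K" "d \<in> K" using \<open>P m c\<close> \<open>P n d\<close> unfolding P_def by blast
    have R: "c \<in> carrier R" "d \<in> carrier R" using K' KR by blast+
    have uM: "u \<in> carrier M" "v \<in> carrier M" using uv HE(1) by blast+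
    have "m \<oplus>\<^bsub>M\<^esub> n = (u \<oplus>\<^bsub>M\<^esub> v) \<oplus>\<^bsub>M\<^esub> (c \<oplus> d) \<odot>\<^bsub>M\<^esub> x"
      unfolding uv(2,4) using uM R x by (simp add: smult_l_distr M.add.m_ac)
    then show ?thesis unfolding P_def using KF.add.m_closed[of c d] K' HE(5)[OF uv(1,3)] by auto
  qed
  have P_smult: "P (c \<odot>\<^bsub>M\<^esub> m) (c \<otimes> d)" if "c \<in> K" "P m d" for m c d
  proof -
    obtain u where u: "u \<in> H" "m = u \<oplus>\<^bsub>M\<^esub> d \<odot>\<^bsub>M\<^esub> x" and d: "d \<in> K"
      using \<open>P m d\<close> unfolding P_def by blast
    have R: "c \<in> carrier R" "d \<in> carrier R" using that d KR by blast+
    have uM: "u \<in> carrier M" using u HE(1) by blast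
    have "c \<odot>\<^bsub>M\<^esub> m = c \<odot>\<^bsub>M\<^esub> u \<oplus>\<^bsub>M\<^esub> (c \<otimes> d) \<odot>\<^bsub>M\<^esub> x"
      unfolding u(2) using uM R x by (simp add: smult_r_distr smult_assoc1)
    then show ?thesis
      unfolding P_def using KF.m_closed[of c d] that(1) d HE(4)[OF that(1) u(1)] by auto
  qed
  define f where "f m = (THE c. P m c)" for m
  have fI: "f m = c" if "P m c" for m c
    unfolding f_def using that P_uniq by blast
  have f: "P m (f m)" if "m \<in> carrier M" for m
    using P_ex[OF that] fI by metis
  have "f \<in> functionals K R M"
    unfolding functionals_def
    using f fI[OF P_add] fI[OF P_smult] P_def by auto
  moreover have "P x \<one>"
    unfolding P_def using KF.one_closed N.submodule_zero[OF H(1)] x by force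
  then have "f x = \<one>" by (rule fI)
  ultimately show ?thesis by blast
qed

text \<open>Vectors are split off one at a time: while the remaining subspace \<open>V\<close> is
  nonzero, a functional with \<open>f v = 1\<close> replaces it by its intersection with the kernel
  of \<open>f\<close>, and the chain condition stops this. The conclusion expresses finite dimension
  without bases.\<close>

lemma (in module) finite_generation_of_dcc:
  assumes K: "subfield K R" and S: "submodule S (R\<lparr>carrier := K\<rparr>) M"
    and dcc: "dcc_on (R\<lparr>carrier := K\<rparr>) M {} S"
  shows "\<exists>A. finite A \<and> A \<subseteq> S \<and> (\<forall>W. submodule W (R\<lparr>carrier := K\<rparr>) M \<and> A \<subseteq> W \<longrightarrow> S \<subseteq> W)"
proof -
  interpret KF: field "R\<lparr>carrier := K\<rparr>" using R.subfield_iff(2)[OF K] .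
  interpret N: module "R\<lparr>carrier := K\<rparr>" M by (rule module_restrict[OF K])
  have KR: "K \<subseteq> carrier R" by (rule subfieldE(3)[OF K])
  have SM: "S \<subseteq> carrier M" by (rule N.submoduleE(1)[OF S])
  \<comment> \<open>\<open>V\<close> and the finite set \<open>A\<close> together generate
    \<open>S\<close>; the aim is to reach \<open>V = 0\<close>.\<close>
  define cof where "cof V A \<longleftrightarrow> submodule V (R\<lparr>carrier := K\<rparr>) M \<and> V \<subseteq> S \<and> finite A \<and> A \<subseteq> S \<and>
     (\<forall>W. submodule W (R\<lparr>carrier := K\<rparr>) M \<and> A \<subseteq> W \<and> V \<subseteq> W \<longrightarrow> S \<subseteq> W)" for V A
  have step: "\<exists>V' A'. cof V' A' \<and> V' \<subset> V" if cof: "cof V A" and ne: "V \<noteq> {\<zero>\<^bsub>M\<^esub>}" for V A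
  proof -
    have V: "submodule V (R\<lparr>carrier := K\<rparr>) M" "V \<subseteq> S" using cof unfolding cof_def by auto
    note VE = N.submoduleE[OF V(1), simplified]
    obtain v where v: "v \<in> V" "v \<noteq> \<zero>\<^bsub>M\<^esub>" using ne N.submodule_zero[OF V(1)] by blast
    have vM: "v \<in> carrier M" using v VE(1) by blast
    obtain f where f: "f \<in> functionals K R M" "f v = \<one>" using ex_functional[OF K vM v(2)] by blast
    note fD = functionalsD[OF f(1)]
    define V' where "V' = {x \<in> V. f x = \<zero>}"
    have f0: "f \<zero>\<^bsub>M\<^esub> = \<zero>" using fD(3)[of \<zero> v] KF.zero_closed vM f(2) by simp
    have V': "submodule V' (R\<lparr>carrier := K\<rparr>) M"
      by (rule N.submoduleI')
        (use VE N.submodule_zero[OF V(1)] f0 KR in \<open>auto simp: V'_def fD(2,3) subset_iff\<close>)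
    have "cof V' (insert v A)"
      unfolding cof_def
    proof (intro conjI allI impI)
      fix W assume W: "submodule W (R\<lparr>carrier := K\<rparr>) M \<and> insert v A \<subseteq> W \<and> V' \<subseteq> W"
      note WE = N.submoduleE[OF conjunct1[OF W], simplified]
      have "V \<subseteq> W"
      proof
        fix x assume x: "x \<in> V"
        have xM: "x \<in> carrier M" using x VE by blast
        have fx: "f x \<in> K" "f x \<in> carrier R" using fD(1)[OF xM] KR by blast+
        \<comment> \<open>The projection of \<open>x\<close> along \<open>v\<close> to the kernel of
          \<open>f\<close>.\<close>
        let ?x' = "x \<oplus>\<^bsub>M\<^esub> (\<ominus> f x) \<odot>\<^bsub>M\<^esub> v"
        have mK: "\<ominus> f x \<in> K" using subringE(5)[OF subfieldE(1)[OF K] fx(1)] .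
        have "?x' \<in> V" using VE(4)[OF mK v(1)] VE(5) x by blast
        moreover have "f ?x' = \<zero>"
          using fD(2,3) xM vM fx mK f(2) KR by (simp add: R.r_neg subset_iff)
        ultimately have "?x' \<in> W" using W unfolding V'_def by blast
        moreover have "f x \<odot>\<^bsub>M\<^esub> v \<in> W" using WE(4) fx W by blast
        ultimately have "?x' \<oplus>\<^bsub>M\<^esub> f x \<odot>\<^bsub>M\<^esub> v \<in> W" using WE(5) by blast
        then show "x \<in> W" using xM vM fx by (simp add: M.a_assoc smult_l_minus M.l_neg)
      qed
      then show "S \<subseteq> W" using W cof unfolding cof_def by blast
    qed (use V' V v cof in \<open>auto simp: cof_def V'_def\<close>)
    moreover have "v \<notin> V'" using f KF.one_not_zero by (simp add: V'_def)
    then have "V' \<subset> V" using v unfolding V'_def by blast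
    ultimately show ?thesis by blast
  qed
  show ?thesis
  proof (rule ccontr)
    assume contra: "\<not> ?thesis"
    \<comment> \<open>If \<open>V\<close> were zero, \<open>A\<close> alone would generate
      \<open>S\<close>. Hence \<open>step\<close> can be repeated forever, and dependent choice
      yields an infinite strictly descending chain inside \<open>S\<close>.\<close>
    have nz: "V \<noteq> {\<zero>\<^bsub>M\<^esub>}" if "cof V A" for V A
    proof
      assume "V = {\<zero>\<^bsub>M\<^esub>}"
      then have "\<forall>W. submodule W (R\<lparr>carrier := K\<rparr>) M \<and> A \<subseteq> W \<longrightarrow> S \<subseteq> W"
        using that N.submodule_zero unfolding cof_def by blast
      then show False using contra that unfolding cof_def by blast
    qed
    have "cof S {}" unfolding cof_def using S by auto
    then obtain g where g: "\<And>n. \<exists>A. cof (g n) A" "\<And>n. g (Suc n) \<subset> g n"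
      using dependent_nat_choice[of "\<lambda>_ V. \<exists>A. cof V A" "\<lambda>_ V V'. V' \<subset> V"] step nz by metis
    have gS: "g (Suc n) \<subseteq> g n" for n using g(2) by blast
    have "\<exists>n. \<forall>i\<ge>n. g i = g n"
      by (rule dcc_onD[OF dcc]) (use g(1) in \<open>auto simp: cof_def dest: subsetD[OF gS]\<close>)
    then show False using g(2) by (metis le_SucI order_refl psubset_eq)
  qed
qed

subsection \<open>Extension of scalars\<close>

lemma (in module) frobenius_action_funpow:
  assumes F: "frobenius_action p R M F"
  shows "x \<in> carrier M \<Longrightarrow> (F ^^ e) x \<in> carrier M"
    and "x \<in> carrier M \<Longrightarrow> y \<in> carrier M \<Longrightarrow> (F ^^ e) (x \<oplus>\<^bsub>M\<^esub> y) = (F ^^ e) x \<oplus>\<^bsub>M\<^esub> (F ^^ e) y"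
    and "a \<in> carrier R \<Longrightarrow> x \<in> carrier M \<Longrightarrow> (F ^^ e) (a \<odot>\<^bsub>M\<^esub> x) = (a [^] (p ^ e)) \<odot>\<^bsub>M\<^esub> (F ^^ e) x"
proof -
  have F': "\<And>x. x \<in> carrier M \<Longrightarrow> F x \<in> carrier M"
    "\<And>x y. x \<in> carrier M \<Longrightarrow> y \<in> carrier M \<Longrightarrow> F (x \<oplus>\<^bsub>M\<^esub> y) = F x \<oplus>\<^bsub>M\<^esub> F y"
    "\<And>a x. a \<in> carrier R \<Longrightarrow> x \<in> carrier M \<Longrightarrow> F (a \<odot>\<^bsub>M\<^esub> x) = (a [^] p) \<odot>\<^bsub>M\<^esub> F x"
    using F unfolding frobenius_action_def hom_def by auto
  show c: "(F ^^ e) x \<in> carrier M" if "x \<in> carrier M" for x e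
    using that by (induction e) (simp_all add: F')
  show "x \<in> carrier M \<Longrightarrow> y \<in> carrier M \<Longrightarrow> (F ^^ e) (x \<oplus>\<^bsub>M\<^esub> y) = (F ^^ e) x \<oplus>\<^bsub>M\<^esub> (F ^^ e) y"
    by (induction e) (simp_all add: F' c)
  show "a \<in> carrier R \<Longrightarrow> x \<in> carrier M \<Longrightarrow> (F ^^ e) (a \<odot>\<^bsub>M\<^esub> x) = (a [^] (p ^ e)) \<odot>\<^bsub>M\<^esub> (F ^^ e) x"
    by (induction e) (simp_all add: F' c R.nat_pow_pow mult.commute)
qed

lemma (in module) frobenius_action_funpow_zero:
  assumes F: "frobenius_action p R M F"
  shows "(F ^^ e) \<zero>\<^bsub>M\<^esub> = \<zero>\<^bsub>M\<^esub>"
proof -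
  note Fp = frobenius_action_funpow[OF F]
  have "(F ^^ e) \<zero>\<^bsub>M\<^esub> \<oplus>\<^bsub>M\<^esub> (F ^^ e) \<zero>\<^bsub>M\<^esub> = (F ^^ e) \<zero>\<^bsub>M\<^esub>"
    using Fp(2)[of "\<zero>\<^bsub>M\<^esub>" "\<zero>\<^bsub>M\<^esub>" e] by simp
  then show ?thesis using Fp(1)[of "\<zero>\<^bsub>M\<^esub>" e] by simp
qed

lemma (in module) frobenius_action_funpow_eq_zeroD:
  assumes F: "frobenius_action p R M F" and inj: "inj_on F (carrier M)"
    and x: "x \<in> carrier M" and "(F ^^ e) x = \<zero>\<^bsub>M\<^esub>"
  shows "x = \<zero>\<^bsub>M\<^esub>"
  using assms(4)
proof (induction e)
  case (Suc e)
  then have "F ((F ^^ e) x) = F \<zero>\<^bsub>M\<^esub>" using frobenius_action_funpow_zero[OF F, of 1] by simp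
  then show ?case using Suc.IH inj_onD[OF inj] frobenius_action_funpow(1)[OF F x] by blast
qed simp

text \<open>An axiomatic substitute for \<open>L \<otimes> M\<close> over \<open>K\<close>. The
  ambient \<open>Y\<close> may be larger than the span of the image of \<open>\<iota>\<close>, and
  apart from \<open>L\<close>-linearity the action of \<open>R\<close> is prescribed only on that
  image. Extending functionals along \<open>\<iota>\<close> is the form in which linear disjointness
  is available. The map \<open>F'\<close> may have a kernel.\<close>

locale frobenius_base_change =
  M: module R M + Y: module L Y
  for R :: "('a, 'c) ring_scheme" and M :: "('a, 'b, 'd) module_scheme"
    and L :: "('l, 'e) ring_scheme" and Y :: "('l, 'y, 'f) module_scheme" +
  fixes K :: "'a set" and h :: "'a \<Rightarrow> 'l" and \<iota> :: "'b \<Rightarrow> 'y" and act :: "'a \<Rightarrow> 'y \<Rightarrow> 'y"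
    and p :: nat and F :: "'b \<Rightarrow> 'b" and F' :: "'y \<Rightarrow> 'y"
  assumes subfield_K: "subfield K R" and field_L: "field L"
    and h_hom: "h \<in> ring_hom (R\<lparr>carrier := K\<rparr>) L"
    and perfect: "c \<in> carrier L \<Longrightarrow> \<exists>d\<in>carrier L. d [^]\<^bsub>L\<^esub> p = c"
    and \<iota>_closed: "x \<in> carrier M \<Longrightarrow> \<iota> x \<in> carrier Y"
    and \<iota>_add: "x \<in> carrier M \<Longrightarrow> x' \<in> carrier M \<Longrightarrow> \<iota> (x \<oplus>\<^bsub>M\<^esub> x') = \<iota> x \<oplus>\<^bsub>Y\<^esub> \<iota> x'"
    and \<iota>_smult: "a \<in> K \<Longrightarrow> x \<in> carrier M \<Longrightarrow> \<iota> (a \<odot>\<^bsub>M\<^esub> x) = h a \<odot>\<^bsub>Y\<^esub> \<iota> x"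
    and functional_extends: "f \<in> functionals K R M \<Longrightarrow>
      \<exists>\<tau>. (\<forall>y\<in>carrier Y. \<tau> y \<in> carrier L) \<and>
        (\<forall>y\<in>carrier Y. \<forall>y'\<in>carrier Y. \<tau> (y \<oplus>\<^bsub>Y\<^esub> y') = \<tau> y \<oplus>\<^bsub>L\<^esub> \<tau> y') \<and>
        (\<forall>c\<in>carrier L. \<forall>y\<in>carrier Y. \<tau> (c \<odot>\<^bsub>Y\<^esub> y) = c \<otimes>\<^bsub>L\<^esub> \<tau> y) \<and>
        (\<forall>x\<in>carrier M. \<tau> (\<iota> x) = h (f x))"
    and act_linear: "a \<in> carrier R \<Longrightarrow> linear_on L Y (carrier Y) (act a)"
    and act_\<iota>: "a \<in> carrier R \<Longrightarrow> x \<in> carrier M \<Longrightarrow> act a (\<iota> x) = \<iota> (a \<odot>\<^bsub>M\<^esub> x)"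
    and F: "frobenius_action p R M F" and F_inj: "inj_on F (carrier M)"
    and F'_closed: "y \<in> carrier Y \<Longrightarrow> F' y \<in> carrier Y"
    and F'_add: "y \<in> carrier Y \<Longrightarrow> y' \<in> carrier Y \<Longrightarrow> F' (y \<oplus>\<^bsub>Y\<^esub> y') = F' y \<oplus>\<^bsub>Y\<^esub> F' y'"
    and F'_smult: "c \<in> carrier L \<Longrightarrow> y \<in> carrier Y \<Longrightarrow> F' (c \<odot>\<^bsub>Y\<^esub> y) = (c [^]\<^bsub>L\<^esub> p) \<odot>\<^bsub>Y\<^esub> F' y"
    and F'_\<iota>: "x \<in> carrier M \<Longrightarrow> F' (\<iota> x) = \<iota> (F x)"
begin

interpretation L: field L by (rule field_L)
interpretation N: module "R\<lparr>carrier := K\<rparr>" M by (rule M.module_restrict[OF subfield_K])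

lemma KR: "K \<subseteq> carrier R" by (rule subfieldE(3)[OF subfield_K])

lemma h_closed: "c \<in> K \<Longrightarrow> h c \<in> carrier L"
  using ring_hom_closed[OF h_hom] by simp

lemma h_one: "h \<one>\<^bsub>R\<^esub> = \<one>\<^bsub>L\<^esub>"
  using ring_hom_one[OF h_hom] by simp

lemmas F_pow_closed = M.frobenius_action_funpow(1)[OF F]
lemmas F_closed = F_pow_closed[where e = 1, simplified]
lemmas F_smult = M.frobenius_action_funpow(3)[OF F, where e = 1, simplified]
lemmas F_pow_eq_zeroD = M.frobenius_action_funpow_eq_zeroD[OF F F_inj]

lemma F_zero: "F \<zero>\<^bsub>M\<^esub> = \<zero>\<^bsub>M\<^esub>"
  using M.frobenius_action_funpow_zero[OF F, of 1] by simp

lemma \<iota>_zero: "\<iota> \<zero>\<^bsub>M\<^esub> = \<zero>\<^bsub>Y\<^esub>"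
proof -
  have "\<iota> \<zero>\<^bsub>M\<^esub> \<oplus>\<^bsub>Y\<^esub> \<iota> \<zero>\<^bsub>M\<^esub> = \<iota> \<zero>\<^bsub>M\<^esub>" using \<iota>_add[of "\<zero>\<^bsub>M\<^esub>" "\<zero>\<^bsub>M\<^esub>"] by simp
  then show ?thesis using \<iota>_closed[of "\<zero>\<^bsub>M\<^esub>"] by simp
qed

text \<open>Functionals separate points of \<open>M\<close>: one with value 1 at a nonzero
  \<open>x\<close> extends to \<open>Y\<close> and takes the value 1 at
  \<open>\<iota> x\<close>.\<close>

lemma \<iota>_eq_zeroD:
  assumes "x \<in> carrier M" "\<iota> x = \<zero>\<^bsub>Y\<^esub>" shows "x = \<zero>\<^bsub>M\<^esub>"
proof (rule ccontr)
  assume "x \<noteq> \<zero>\<^bsub>M\<^esub>"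
  then obtain f where f: "f \<in> functionals K R M" "f x = \<one>\<^bsub>R\<^esub>"
    using M.ex_functional[OF subfield_K] assms(1) by blast
  obtain \<tau> where \<tau>: "\<And>c y. c \<in> carrier L \<Longrightarrow> y \<in> carrier Y \<Longrightarrow> \<tau> (c \<odot>\<^bsub>Y\<^esub> y) = c \<otimes>\<^bsub>L\<^esub> \<tau> y"
    "\<And>y. y \<in> carrier Y \<Longrightarrow> \<tau> y \<in> carrier L" "\<tau> (\<iota> x) = h (f x)"
    using functional_extends[OF f(1)] assms(1) by blast
  have "\<tau> \<zero>\<^bsub>Y\<^esub> = \<zero>\<^bsub>L\<^esub>" using \<tau>(1)[of "\<zero>\<^bsub>L\<^esub>" "\<zero>\<^bsub>Y\<^esub>"] \<tau>(2)[of "\<zero>\<^bsub>Y\<^esub>"] by simp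
  then show False using \<tau>(3) assms(2) f(2) h_one L.one_not_zero by simp
qed

section \<open>Linear combinations and extended subspaces\<close>

primrec lin_comb :: "('l \<times> 'b) list \<Rightarrow> 'y" where
  "lin_comb [] = \<zero>\<^bsub>Y\<^esub>"
| "lin_comb (z # zs) = fst z \<odot>\<^bsub>Y\<^esub> \<iota> (snd z) \<oplus>\<^bsub>Y\<^esub> lin_comb zs"

text \<open>For a subspace \<open>N\<close> this is the image of \<open>L \<otimes> N\<close> in
  \<open>Y\<close>. Explicit lists of terms are kept because \<open>lin_comb_kernel\<close> inducts
  on the number of terms.\<close>

definition scalar_ext :: "'b set \<Rightarrow> 'y set" where
  "scalar_ext N = lin_comb ` {zs. set zs \<subseteq> carrier L \<times> N}"

lemma lin_comb_closed: "set zs \<subseteq> carrier L \<times> carrier M \<Longrightarrow> lin_comb zs \<in> carrier Y"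
  by (induction zs) (auto simp: \<iota>_closed)

lemma lin_comb_append:
  assumes "set zs \<subseteq> carrier L \<times> carrier M" "set ws \<subseteq> carrier L \<times> carrier M"
  shows "lin_comb (zs @ ws) = lin_comb zs \<oplus>\<^bsub>Y\<^esub> lin_comb ws"
  using assms(1) by (induction zs) (use assms(2) in \<open>auto simp: \<iota>_closed lin_comb_closed Y.M.a_assoc\<close>)

lemma lin_comb_smult:
  assumes "set zs \<subseteq> carrier L \<times> carrier M" "c \<in> carrier L"
  shows "lin_comb (map (apfst ((\<otimes>\<^bsub>L\<^esub>) c)) zs) = c \<odot>\<^bsub>Y\<^esub> lin_comb zs"
  using assms(1) by (induction zs) (use assms(2) in \<open>auto simp: \<iota>_closed lin_comb_closed Y.smult_assoc1 Y.smult_r_distr\<close>)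

lemma ext_submodule:
  assumes "N \<subseteq> carrier M" shows "submodule (scalar_ext N) L Y"
proof (rule Y.submoduleI')
  have *: "carrier L \<times> N \<subseteq> carrier L \<times> carrier M" using assms by blast
  show "scalar_ext N \<subseteq> carrier Y" unfolding scalar_ext_def using lin_comb_closed * by blast
  have "lin_comb [] \<in> scalar_ext N" unfolding scalar_ext_def by (rule imageI) simp
  then show "\<zero>\<^bsub>Y\<^esub> \<in> scalar_ext N" by simp
next
  fix x y assume "x \<in> scalar_ext N" "y \<in> scalar_ext N"
  then obtain zs ws where *: "x = lin_comb zs" "y = lin_comb ws" "set zs \<subseteq> carrier L \<times> N" "set ws \<subseteq> carrier L \<times> N"
    unfolding scalar_ext_def by blast
  moreover have "carrier L \<times> N \<subseteq> carrier L \<times> carrier M" using assms by blast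
  ultimately have "x \<oplus>\<^bsub>Y\<^esub> y = lin_comb (zs @ ws)" using lin_comb_append[of zs ws] by (metis order_trans)
  then show "x \<oplus>\<^bsub>Y\<^esub> y \<in> scalar_ext N" unfolding scalar_ext_def using * by auto
next
  fix c x assume c: "c \<in> carrier L" and "x \<in> scalar_ext N"
  then obtain zs where *: "x = lin_comb zs" "set zs \<subseteq> carrier L \<times> N"
    unfolding scalar_ext_def by blast
  moreover have "carrier L \<times> N \<subseteq> carrier L \<times> carrier M" using assms by blast
  ultimately have "c \<odot>\<^bsub>Y\<^esub> x = lin_comb (map (apfst ((\<otimes>\<^bsub>L\<^esub>) c)) zs)" using lin_comb_smult[of zs c] c by (metis order_trans)
  moreover have "set (map (apfst ((\<otimes>\<^bsub>L\<^esub>) c)) zs) \<subseteq> carrier L \<times> N" using * c by auto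
  ultimately show "c \<odot>\<^bsub>Y\<^esub> x \<in> scalar_ext N" unfolding scalar_ext_def by blast
qed

lemma \<iota>_in_ext: 
  assumes "N \<subseteq> carrier M" "x \<in> N" shows "\<iota> x \<in> scalar_ext N"
proof -
  have "lin_comb [(\<one>\<^bsub>L\<^esub>, x)] \<in> scalar_ext N" unfolding scalar_ext_def by (rule imageI) (use assms in simp)
  then show ?thesis using \<iota>_closed assms by auto
qed

lemma ext_least:
  assumes "submodule W L Y" "\<And>x. x \<in> N \<Longrightarrow> \<iota> x \<in> W" "y \<in> scalar_ext N"
  shows "y \<in> W"
proof -
  obtain zs where zs: "y = lin_comb zs" "set zs \<subseteq> carrier L \<times> N" using assms(3) unfolding scalar_ext_def by blast
  have "lin_comb zs \<in> W" using zs(2)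
  proof (induction zs)
    case Nil
    show ?case using Y.submodule_zero[OF assms(1)] by simp
  next
    case (Cons z zs)
    then show ?case using Y.submoduleE(4,5)[OF assms(1)] assms(2) by auto
  qed
  then show ?thesis using zs by simp
qed

lemma ext_induct [consumes 2, case_names generator zero add smult]:
  assumes "y \<in> scalar_ext N" "N \<subseteq> carrier M"
    and "\<And>x. x \<in> N \<Longrightarrow> P (\<iota> x)" "P \<zero>\<^bsub>Y\<^esub>"
    and "\<And>y y'. y \<in> scalar_ext N \<Longrightarrow> y' \<in> scalar_ext N \<Longrightarrow> P y \<Longrightarrow> P y' \<Longrightarrow> P (y \<oplus>\<^bsub>Y\<^esub> y')"
    and "\<And>c y. c \<in> carrier L \<Longrightarrow> y \<in> scalar_ext N \<Longrightarrow> P y \<Longrightarrow> P (c \<odot>\<^bsub>Y\<^esub> y)"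
  shows "P y"
proof -
  note S = ext_submodule[OF assms(2)]
  have "submodule {y \<in> scalar_ext N. P y} L Y"
    by (rule Y.submoduleI') (use Y.submoduleE(1,4,5)[OF S] Y.submodule_zero[OF S] assms(4-) in auto)
  then have "y \<in> {y \<in> scalar_ext N. P y}"
    by (rule ext_least) (use assms \<iota>_in_ext in auto)
  then show ?thesis by simp
qed

lemma ext_mono: "N \<subseteq> N' \<Longrightarrow> scalar_ext N \<subseteq> scalar_ext N'"
  unfolding scalar_ext_def by blast

text \<open>
  This is where the linear disjointness of \<open>K\<close>-independent families over \<open>L\<close> enters: a relation
  detected by a functional allows one term of a linear combination to be eliminated.
\<close>

lemma lin_comb_kernel:
  assumes N: "submodule N (R\<lparr>carrier := K\<rparr>) M" and a: "a \<in> carrier R"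
    and "set zs \<subseteq> carrier L \<times> N" "act a (lin_comb zs) = \<zero>\<^bsub>Y\<^esub>"
  shows "lin_comb zs \<in> scalar_ext {x \<in> N. a \<odot>\<^bsub>M\<^esub> x = \<zero>\<^bsub>M\<^esub>}" (is "_ \<in> scalar_ext ?N0")
  using assms(3,4)
proof (induction "length zs" arbitrary: zs)
  case 0
  then show ?case unfolding scalar_ext_def by (intro imageI) simp
next
  case (Suc n)
  have NM: "N \<subseteq> carrier M" by (rule N.submoduleE(1)[OF N])
  then have N0M: "?N0 \<subseteq> carrier M" by blast
  note actD = Y.linear_onD[OF act_linear[OF a]]
  obtain c x ws where zs: "zs = (c, x) # ws" using Suc(2) by (metis length_Suc_conv surj_pair)
  have c: "c \<in> carrier L" and x: "x \<in> N" "x \<in> carrier M" and ws: "set ws \<subseteq> carrier L \<times> N"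
    and len: "n = length ws"
    using Suc(2,3) NM zs by auto
  have ws': "set ws \<subseteq> carrier L \<times> carrier M" using ws NM by blast
  note wsY = lin_comb_closed[OF ws']
  have eq: "c \<odot>\<^bsub>Y\<^esub> \<iota> (a \<odot>\<^bsub>M\<^esub> x) \<oplus>\<^bsub>Y\<^esub> act a (lin_comb ws) = \<zero>\<^bsub>Y\<^esub>"
    using Suc(4) zs c x wsY a by (simp add: actD \<iota>_closed act_\<iota>)
  show ?case
  \<comment> \<open>If \<open>a\<close> kills \<open>x\<close>, the first term already lies in the
    extension and can be set aside. Otherwise a functional equal to 1 at \<open>a x\<close> serves
    to eliminate \<open>x\<close>.\<close>
  proof (cases "a \<odot>\<^bsub>M\<^esub> x = \<zero>\<^bsub>M\<^esub>")
    case True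
    then have "act a (lin_comb ws) = \<zero>\<^bsub>Y\<^esub>" using eq c wsY actD(1) by (simp add: \<iota>_zero)
    then have "lin_comb ws \<in> scalar_ext ?N0" using Suc(1)[OF len ws] by blast
    moreover have "\<iota> x \<in> scalar_ext ?N0" using \<iota>_in_ext[OF N0M] x True by blast
    ultimately show ?thesis
      using zs c Y.submoduleE(4,5)[OF ext_submodule[OF N0M]] by simp
  next
    case False
    have "a \<odot>\<^bsub>M\<^esub> x \<in> carrier M" using a x by simp
    then obtain f where f: "f \<in> functionals K R M" "f (a \<odot>\<^bsub>M\<^esub> x) = \<one>\<^bsub>R\<^esub>"
      using M.ex_functional[OF subfield_K _ False] by blast
    note fD = functionalsD[OF f(1)]
    obtain \<tau> where \<tau>: "\<And>y. y \<in> carrier Y \<Longrightarrow> \<tau> y \<in> carrier L"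
      "\<And>y y'. y \<in> carrier Y \<Longrightarrow> y' \<in> carrier Y \<Longrightarrow> \<tau> (y \<oplus>\<^bsub>Y\<^esub> y') = \<tau> y \<oplus>\<^bsub>L\<^esub> \<tau> y'"
      "\<And>c y. c \<in> carrier L \<Longrightarrow> y \<in> carrier Y \<Longrightarrow> \<tau> (c \<odot>\<^bsub>Y\<^esub> y) = c \<otimes>\<^bsub>L\<^esub> \<tau> y"
      "\<And>x. x \<in> carrier M \<Longrightarrow> \<tau> (\<iota> x) = h (f x)"
      using functional_extends[OF f(1)] by blast
    have \<tau>0: "\<tau> \<zero>\<^bsub>Y\<^esub> = \<zero>\<^bsub>L\<^esub>" using \<tau>(3)[of "\<zero>\<^bsub>L\<^esub>" "\<zero>\<^bsub>Y\<^esub>"] \<tau>(1)[of "\<zero>\<^bsub>Y\<^esub>"] by simp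
    \<comment> \<open>\<open>g\<close> subtracts the multiple of \<open>x\<close> that makes
      \<open>f (a (g x'))\<close> vanish.\<close>
    define g where "g x' = x' \<oplus>\<^bsub>M\<^esub> (\<ominus>\<^bsub>R\<^esub> f (a \<odot>\<^bsub>M\<^esub> x')) \<odot>\<^bsub>M\<^esub> x" for x'
    define vs where "vs = map (apsnd g) ws"
    have fK: "f (a \<odot>\<^bsub>M\<^esub> x') \<in> K" "\<ominus>\<^bsub>R\<^esub> f (a \<odot>\<^bsub>M\<^esub> x') \<in> K" if "x' \<in> carrier M" for x'
      using fD(1)[of "a \<odot>\<^bsub>M\<^esub> x'"] a that subringE(5)[OF subfieldE(1)[OF subfield_K]] by auto
    have gN: "g x' \<in> N" if "x' \<in> N" for x'
      using fK[of x'] N.submoduleE(4,5)[OF N] that x NM unfolding g_def by auto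
    have vs: "set vs \<subseteq> carrier L \<times> N" using ws gN unfolding vs_def by auto
    have g_eq: "\<iota> (g x') \<oplus>\<^bsub>Y\<^esub> h (f (a \<odot>\<^bsub>M\<^esub> x')) \<odot>\<^bsub>Y\<^esub> \<iota> x = \<iota> x'" if x': "x' \<in> carrier M" for x'
    proof -
      have k: "f (a \<odot>\<^bsub>M\<^esub> x') \<in> carrier R" "g x' \<in> carrier M"
        using fK[OF x'] KR x x' unfolding g_def by blast+
      have "g x' \<oplus>\<^bsub>M\<^esub> f (a \<odot>\<^bsub>M\<^esub> x') \<odot>\<^bsub>M\<^esub> x = x'"
        using k x x' by (simp add: g_def M.M.a_assoc M.smult_l_minus M.M.l_neg)
      then show ?thesis using \<iota>_add[of "g x'" "f (a \<odot>\<^bsub>M\<^esub> x') \<odot>\<^bsub>M\<^esub> x"] \<iota>_smult[OF fK(1)[OF x'] x(2)] k x(2)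
        by simp
    qed
    \<comment> \<open>Replacing each vector by its \<open>g\<close>-image changes the sum by a
      multiple of \<open>\<iota> x\<close>. The values \<open>h (f (a x'))\<close>, weighted by the
      coefficients in \<open>L\<close>, add up to \<open>\<tau>\<close> of the image under
      \<open>act a\<close>.\<close>
    have split: "lin_comb (map (apsnd g) us) \<oplus>\<^bsub>Y\<^esub> \<tau> (act a (lin_comb us)) \<odot>\<^bsub>Y\<^esub> \<iota> x = lin_comb us"
      if "set us \<subseteq> carrier L \<times> N" for us
      using that
    proof (induction us)
      case Nil
      have "act a \<zero>\<^bsub>Y\<^esub> = \<zero>\<^bsub>Y\<^esub>"
        by (rule Y.linear_on_zero[OF act_linear[OF a] Y.carrier_is_submodule])
      then show ?case using x by (simp add: \<tau>0 \<iota>_closed)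
    next
      case (Cons u us)
      obtain d w where u: "u = (d, w)" "d \<in> carrier L" "w \<in> N" using Cons.prems by auto
      have w: "w \<in> carrier M" "g w \<in> carrier M" using u NM gN by blast+
      have gM: "g w \<in> carrier M" if "w \<in> N" for w using gN[OF that] NM by blast
      have us: "set us \<subseteq> carrier L \<times> N" "set us \<subseteq> carrier L \<times> carrier M"
        "set (map (apsnd g) us) \<subseteq> carrier L \<times> carrier M" using Cons.prems gM NM by auto
      have hY: "h (f (a \<odot>\<^bsub>M\<^esub> w)) \<in> carrier L" using fK(1)[OF w(1)] by (rule h_closed)
      note cl = lin_comb_closed[OF us(2)] lin_comb_closed[OF us(3)]
      have \<tau>cl: "\<tau> (act a (lin_comb us)) \<in> carrier L" using \<tau>(1) actD(1) cl by blast
      have aw: "a \<odot>\<^bsub>M\<^esub> w \<in> carrier M" using a w by simp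
      have t: "\<tau> (act a (lin_comb (u # us))) = d \<otimes>\<^bsub>L\<^esub> h (f (a \<odot>\<^bsub>M\<^esub> w)) \<oplus>\<^bsub>L\<^esub> \<tau> (act a (lin_comb us))"
        using u w cl a aw by (simp add: actD \<iota>_closed act_\<iota> \<tau>)
      have "lin_comb (map (apsnd g) (u # us)) \<oplus>\<^bsub>Y\<^esub> \<tau> (act a (lin_comb (u # us))) \<odot>\<^bsub>Y\<^esub> \<iota> x
        = (d \<odot>\<^bsub>Y\<^esub> \<iota> (g w) \<oplus>\<^bsub>Y\<^esub> lin_comb (map (apsnd g) us)) \<oplus>\<^bsub>Y\<^esub>
          (d \<odot>\<^bsub>Y\<^esub> (h (f (a \<odot>\<^bsub>M\<^esub> w)) \<odot>\<^bsub>Y\<^esub> \<iota> x) \<oplus>\<^bsub>Y\<^esub> \<tau> (act a (lin_comb us)) \<odot>\<^bsub>Y\<^esub> \<iota> x)"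
        unfolding t using u hY \<tau>cl x by (simp add: Y.smult_l_distr \<iota>_closed Y.smult_assoc1)
      also have "\<dots> = d \<odot>\<^bsub>Y\<^esub> (\<iota> (g w) \<oplus>\<^bsub>Y\<^esub> h (f (a \<odot>\<^bsub>M\<^esub> w)) \<odot>\<^bsub>Y\<^esub> \<iota> x) \<oplus>\<^bsub>Y\<^esub>
          (lin_comb (map (apsnd g) us) \<oplus>\<^bsub>Y\<^esub> \<tau> (act a (lin_comb us)) \<odot>\<^bsub>Y\<^esub> \<iota> x)"
        using u(2) hY \<tau>cl x w cl by (simp add: Y.smult_r_distr \<iota>_closed Y.M.add.m_ac)
      also have "\<dots> = lin_comb (u # us)" unfolding g_eq[OF w(1)] Cons.IH[OF us(1)] using u by simp
      finally show ?case .
    qed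
    let ?s = "\<tau> (act a (lin_comb ws))"
    have s: "?s \<in> carrier L" using \<tau>(1) actD(1) wsY by blast
    \<comment> \<open>Applying \<open>\<tau>\<close> to \<open>eq\<close> shows that the total
      coefficient of \<open>\<iota> x\<close> is zero, so the sum equals the combination
      \<open>vs\<close>, which has one term fewer.\<close>
    have "\<tau> (c \<odot>\<^bsub>Y\<^esub> \<iota> (a \<odot>\<^bsub>M\<^esub> x) \<oplus>\<^bsub>Y\<^esub> act a (lin_comb ws)) = c \<oplus>\<^bsub>L\<^esub> ?s"
      using c a x wsY f(2) by (simp add: \<tau> \<iota>_closed actD h_one)
    then have cs: "c \<oplus>\<^bsub>L\<^esub> ?s = \<zero>\<^bsub>L\<^esub>" using eq \<tau>0 by simp
    have vsY: "lin_comb vs \<in> carrier Y" using vs NM by (intro lin_comb_closed) blast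
    have "lin_comb zs = c \<odot>\<^bsub>Y\<^esub> \<iota> x \<oplus>\<^bsub>Y\<^esub> (lin_comb vs \<oplus>\<^bsub>Y\<^esub> ?s \<odot>\<^bsub>Y\<^esub> \<iota> x)"
      using split[OF ws] zs unfolding vs_def by simp
    also have "\<dots> = lin_comb vs \<oplus>\<^bsub>Y\<^esub> (c \<oplus>\<^bsub>L\<^esub> ?s) \<odot>\<^bsub>Y\<^esub> \<iota> x"
      using c s x vsY by (simp add: Y.smult_l_distr \<iota>_closed Y.M.add.m_ac)
    also have "\<dots> = lin_comb vs" unfolding cs using x vsY by (simp add: \<iota>_closed)
    finally have *: "lin_comb zs = lin_comb vs" .
    have "lin_comb vs \<in> scalar_ext ?N0"
      by (rule Suc(1)) (use len vs * Suc(4) in \<open>auto simp: vs_def\<close>)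
    then show ?thesis using * by simp
  qed
qed

section \<open>Annihilators and the action of \<open>R\<close> on the extension\<close>

definition annihilated :: "'a set \<Rightarrow> 'b set" where
  "annihilated B = {x \<in> carrier M. \<forall>a\<in>B. a \<odot>\<^bsub>M\<^esub> x = \<zero>\<^bsub>M\<^esub>}"

lemma annihilated_smult:
  assumes "B \<subseteq> carrier R" "a \<in> carrier R" "x \<in> annihilated B"
  shows "a \<odot>\<^bsub>M\<^esub> x \<in> annihilated B"
proof -
  have "b \<odot>\<^bsub>M\<^esub> (a \<odot>\<^bsub>M\<^esub> x) = \<zero>\<^bsub>M\<^esub>" if "b \<in> B" for b
  proof -
    have b: "b \<in> carrier R" using that assms by blast
    have "b \<odot>\<^bsub>M\<^esub> (a \<odot>\<^bsub>M\<^esub> x) = a \<odot>\<^bsub>M\<^esub> (b \<odot>\<^bsub>M\<^esub> x)"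
      using M.smult_assoc1[of a b x] M.smult_assoc1[of b a x] M.R.m_comm[of a b] b assms(2,3)
      unfolding annihilated_def by simp
    then show ?thesis using that assms unfolding annihilated_def by simp
  qed
  then show ?thesis using assms unfolding annihilated_def by simp
qed

lemma annihilated_submodule:
  assumes "B \<subseteq> carrier R"
  shows "submodule (annihilated B) (R\<lparr>carrier := K\<rparr>) M"
proof (rule N.submoduleI')
  fix x y assume "x \<in> annihilated B" "y \<in> annihilated B"
  then show "x \<oplus>\<^bsub>M\<^esub> y \<in> annihilated B"
    using assms unfolding annihilated_def by (auto simp: M.smult_r_distr subset_iff)
qed (use assms KR annihilated_smult in \<open>auto simp: annihilated_def\<close>)

lemma annihilated_carrier: "annihilated B \<subseteq> carrier M"
  unfolding annihilated_def by blast

lemma act_ext: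
  assumes "N \<subseteq> carrier M" "a \<in> carrier R" "\<And>x. x \<in> N \<Longrightarrow> a \<odot>\<^bsub>M\<^esub> x \<in> N" "y \<in> scalar_ext N"
  shows "act a y \<in> scalar_ext N"
  using assms(4,1)
proof (induction rule: ext_induct)
  case zero
  show ?case using Y.linear_on_zero[OF act_linear[OF assms(2)] Y.carrier_is_submodule]
      Y.submodule_zero[OF ext_submodule[OF assms(1)]] by simp
next
  case (add y y')
  then have "y \<in> carrier Y" "y' \<in> carrier Y" using Y.submoduleE(1)[OF ext_submodule[OF assms(1)]] by blast+
  then show ?case using add Y.linear_onD(2)[OF act_linear[OF assms(2)]]
      Y.submoduleE(5)[OF ext_submodule[OF assms(1)]] by simp
next
  case (smult c y)
  then have "y \<in> carrier Y" using Y.submoduleE(1)[OF ext_submodule[OF assms(1)]] by blast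
  then show ?case using smult Y.linear_onD(3)[OF act_linear[OF assms(2)]]
      Y.submoduleE(4)[OF ext_submodule[OF assms(1)]] by simp
qed (use assms(1-3) act_\<iota> \<iota>_in_ext in \<open>auto simp: subset_iff\<close>)

lemma act_linear_ext:
  assumes "N \<subseteq> carrier M" "a \<in> carrier R" "\<And>x. x \<in> N \<Longrightarrow> a \<odot>\<^bsub>M\<^esub> x \<in> N"
  shows "linear_on L Y (scalar_ext N) (act a)"
  using act_ext[OF assms] act_linear[OF assms(2)] Y.submoduleE(1)[OF ext_submodule[OF assms(1)]]
  unfolding linear_on_def by (auto simp: subset_iff)

abbreviation "MY \<equiv> scalar_ext (carrier M)"

lemma MY_submodule: "submodule MY L Y"
  by (rule ext_submodule) simp

lemma MY_closed: "y \<in> MY \<Longrightarrow> y \<in> carrier Y"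
  using Y.submoduleE(1)[OF MY_submodule] by blast

lemma act_MY: "a \<in> carrier R \<Longrightarrow> y \<in> MY \<Longrightarrow> act a y \<in> MY"
  by (rule act_ext) auto

lemma act_zero: "a \<in> carrier R \<Longrightarrow> act a \<zero>\<^bsub>Y\<^esub> = \<zero>\<^bsub>Y\<^esub>"
  using Y.linear_on_zero[OF act_linear Y.carrier_is_submodule] .

lemma act_add:
  "a \<in> carrier R \<Longrightarrow> y \<in> carrier Y \<Longrightarrow> y' \<in> carrier Y \<Longrightarrow> act a (y \<oplus>\<^bsub>Y\<^esub> y') = act a y \<oplus>\<^bsub>Y\<^esub> act a y'"
  using Y.linear_onD(2)[OF act_linear] .

lemma act_smult:
  "a \<in> carrier R \<Longrightarrow> c \<in> carrier L \<Longrightarrow> y \<in> carrier Y \<Longrightarrow> act a (c \<odot>\<^bsub>Y\<^esub> y) = c \<odot>\<^bsub>Y\<^esub> act a y"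
  using Y.linear_onD(3)[OF act_linear] .

lemma act_closed: "a \<in> carrier R \<Longrightarrow> y \<in> carrier Y \<Longrightarrow> act a y \<in> carrier Y"
  using Y.linear_onD(1)[OF act_linear] .

text \<open>\<open>act\<close> is tied to the module structure only through \<open>\<iota>\<close>,
  so multiplicativity is checked on generators and claimed on their span \<open>MY\<close>.\<close>

lemma act_mult:
  assumes "a \<in> carrier R" "b \<in> carrier R" "y \<in> MY"
  shows "act a (act b y) = act (a \<otimes>\<^bsub>R\<^esub> b) y"
  using assms(3) order_refl
proof (induction rule: ext_induct)
  case (generator x)
  then show ?case using assms by (simp add: act_\<iota> M.smult_assoc1)
qed (use assms MY_closed in \<open>auto simp: act_zero act_add act_smult act_closed\<close>)

lemma act_commute:
  assumes "a \<in> carrier R" "b \<in> carrier R" "y \<in> MY"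
  shows "act a (act b y) = act b (act a y)"
  using act_mult assms M.R.m_comm by metis

section \<open>The semilinear map \<open>F'\<close> and its nilpotent elements\<close>

lemma F'_zero: "F' \<zero>\<^bsub>Y\<^esub> = \<zero>\<^bsub>Y\<^esub>"
  using F'_\<iota>[of "\<zero>\<^bsub>M\<^esub>"] by (simp add: \<iota>_zero F_zero)

lemma F'_MY:
  assumes "y \<in> MY" shows "F' y \<in> MY"
  using assms order_refl
proof (induction rule: ext_induct)
  case (generator x)
  then show ?case using \<iota>_in_ext[of "carrier M"] by (simp add: F'_\<iota> F_closed)
next
  case zero
  show ?case using Y.submodule_zero[OF MY_submodule] by (simp add: F'_zero)
next
  case (add y y')
  then show ?case using Y.submoduleE(5)[OF MY_submodule] by (simp add: F'_add MY_closed)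
next
  case (smult c y)
  then show ?case using Y.submoduleE(4)[OF MY_submodule] by (simp add: F'_smult MY_closed)
qed

lemma F'_act:
  assumes "a \<in> carrier R" "y \<in> MY"
  shows "F' (act a y) = act (a [^]\<^bsub>R\<^esub> p) (F' y)"
  using assms(2) order_refl
proof (induction rule: ext_induct)
  case (generator x)
  then show ?case using assms by (simp add: act_\<iota> F'_\<iota> F_smult F_closed)
qed (use assms MY_closed in \<open>auto simp: act_zero act_add act_smult act_closed F'_zero F'_add F'_smult F'_closed\<close>)

lemma F'_pow_closed: "y \<in> carrier Y \<Longrightarrow> (F' ^^ n) y \<in> carrier Y"
  by (induction n) (simp_all add: F'_closed)

lemma F'_pow_MY: "y \<in> MY \<Longrightarrow> (F' ^^ n) y \<in> MY"
  by (induction n) (simp_all add: F'_MY)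

lemma F'_pow_zero: "(F' ^^ n) \<zero>\<^bsub>Y\<^esub> = \<zero>\<^bsub>Y\<^esub>"
  by (induction n) (simp_all add: F'_zero)

lemma F'_pow_add:
  "y \<in> carrier Y \<Longrightarrow> y' \<in> carrier Y \<Longrightarrow> (F' ^^ n) (y \<oplus>\<^bsub>Y\<^esub> y') = (F' ^^ n) y \<oplus>\<^bsub>Y\<^esub> (F' ^^ n) y'"
  by (induction n) (simp_all add: F'_add F'_pow_closed)

lemma F'_pow_smult:
  "c \<in> carrier L \<Longrightarrow> y \<in> carrier Y \<Longrightarrow> (F' ^^ n) (c \<odot>\<^bsub>Y\<^esub> y) = (c [^]\<^bsub>L\<^esub> (p ^ n)) \<odot>\<^bsub>Y\<^esub> (F' ^^ n) y"
  by (induction n) (simp_all add: F'_smult F'_pow_closed Y.R.nat_pow_pow mult.commute)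

lemma F'_pow_act:
  "a \<in> carrier R \<Longrightarrow> y \<in> MY \<Longrightarrow> (F' ^^ n) (act a y) = act (a [^]\<^bsub>R\<^esub> (p ^ n)) ((F' ^^ n) y)"
  by (induction n) (simp_all add: F'_act F'_pow_MY M.R.nat_pow_pow mult.commute)

lemma F'_pow_\<iota>: "x \<in> carrier M \<Longrightarrow> (F' ^^ n) (\<iota> x) = \<iota> ((F ^^ n) x)"
  by (induction n) (simp_all add: F'_\<iota> F_pow_closed)

text \<open>This measures the failure of injectivity of \<open>F'\<close>: if
  \<open>F x = c F y\<close> with \<open>c\<close> in \<open>K\<close> not a \<open>p\<close>-th
  power in \<open>K\<close>, and \<open>d\<close> in \<open>L\<close> is a \<open>p\<close>-th root
  of \<open>h c\<close>, then \<open>F'\<close> kills \<open>\<iota> x - d \<iota> y\<close>.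
  Arguments in \<open>MY\<close> are therefore made modulo this subspace.\<close>

definition nilpotents :: "'y set" where
  "nilpotents = {y \<in> MY. \<exists>n. (F' ^^ n) y = \<zero>\<^bsub>Y\<^esub>}"

lemma F'_pow_zero_mono:
  assumes "(F' ^^ m) y = \<zero>\<^bsub>Y\<^esub>" "m \<le> n" shows "(F' ^^ n) y = \<zero>\<^bsub>Y\<^esub>"
proof -
  have "(F' ^^ n) y = (F' ^^ (n - m)) ((F' ^^ m) y)"
    using assms(2) by (metis comp_apply funpow_add le_add_diff_inverse2)
  then show ?thesis using assms(1) by (simp add: F'_pow_zero)
qed

lemma nilpotents_submodule: "submodule nilpotents L Y"
proof (rule Y.submoduleI')
  show "nilpotents \<subseteq> carrier Y" using MY_closed unfolding nilpotents_def by blast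
  show "\<zero>\<^bsub>Y\<^esub> \<in> nilpotents"
    using Y.submodule_zero[OF MY_submodule] F'_pow_zero unfolding nilpotents_def by blast
next
  fix x y assume "x \<in> nilpotents" "y \<in> nilpotents"
  then obtain m n where *: "x \<in> MY" "y \<in> MY" "(F' ^^ m) x = \<zero>\<^bsub>Y\<^esub>" "(F' ^^ n) y = \<zero>\<^bsub>Y\<^esub>"
    unfolding nilpotents_def by blast
  then have "(F' ^^ max m n) x = \<zero>\<^bsub>Y\<^esub>" "(F' ^^ max m n) y = \<zero>\<^bsub>Y\<^esub>"
    using F'_pow_zero_mono max.cobounded1 max.cobounded2 by blast+
  then have "(F' ^^ max m n) (x \<oplus>\<^bsub>Y\<^esub> y) = \<zero>\<^bsub>Y\<^esub>" using * by (simp add: F'_pow_add MY_closed)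
  then show "x \<oplus>\<^bsub>Y\<^esub> y \<in> nilpotents"
    using * Y.submoduleE(5)[OF MY_submodule] unfolding nilpotents_def by blast
next
  fix c x assume "c \<in> carrier L" "x \<in> nilpotents"
  then obtain m where *: "x \<in> MY" "(F' ^^ m) x = \<zero>\<^bsub>Y\<^esub>" "c \<in> carrier L"
    unfolding nilpotents_def by blast
  then have "(F' ^^ m) (c \<odot>\<^bsub>Y\<^esub> x) = \<zero>\<^bsub>Y\<^esub>" by (simp add: F'_pow_smult MY_closed)
  then show "c \<odot>\<^bsub>Y\<^esub> x \<in> nilpotents"
    using * Y.submoduleE(4)[OF MY_submodule] unfolding nilpotents_def by blast
qed

lemma act_nilpotents:
  assumes "a \<in> carrier R" "y \<in> nilpotents" shows "act a y \<in> nilpotents"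
proof -
  obtain m where *: "y \<in> MY" "(F' ^^ m) y = \<zero>\<^bsub>Y\<^esub>" using assms unfolding nilpotents_def by blast
  then have "(F' ^^ m) (act a y) = \<zero>\<^bsub>Y\<^esub>" using assms by (simp add: F'_pow_act act_zero)
  then show ?thesis using act_MY assms(1) * unfolding nilpotents_def by blast
qed

section \<open>The descending chain condition on \<open>MY\<close>\<close>

lemma act_locally_nilpotent:
  assumes a: "a \<in> carrier R" and nil: "\<And>x. x \<in> carrier M \<Longrightarrow> \<exists>k::nat. (a [^]\<^bsub>R\<^esub> k) \<odot>\<^bsub>M\<^esub> x = \<zero>\<^bsub>M\<^esub>"
    and y: "y \<in> MY"
  shows "\<exists>k. (act a ^^ k) y = \<zero>\<^bsub>Y\<^esub>"
  using y order_refl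
proof (induction rule: ext_induct)
  note lin = Y.linear_on_funpow[OF act_linear[OF a]]
  note linD = Y.linear_onD[OF lin]
  have mono: "(act a ^^ n) y = \<zero>\<^bsub>Y\<^esub>" if "(act a ^^ m) y = \<zero>\<^bsub>Y\<^esub>" "m \<le> n" for m n y
  proof -
    have "(act a ^^ n) y = (act a ^^ (n - m)) ((act a ^^ m) y)"
      using that(2) by (metis comp_apply funpow_add le_add_diff_inverse2)
    then show ?thesis using that(1) Y.linear_on_zero[OF lin Y.carrier_is_submodule] by simp
  qed
  {
    case (generator x)
    have "(act a ^^ k) (\<iota> x) = \<iota> ((a [^]\<^bsub>R\<^esub> k) \<odot>\<^bsub>M\<^esub> x)" for k :: nat
    proof (induction k)
      case (Suc k)
      then show ?case using generator a
        by (simp add: act_\<iota> M.smult_assoc1[symmetric] M.R.m_comm)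
    qed (use generator in simp)
    then show ?case using nil[OF generator] \<iota>_zero by metis
  next
    case zero
    then show ?case by (metis funpow_0)
  next
    case (add y y')
    then obtain m n where "(act a ^^ m) y = \<zero>\<^bsub>Y\<^esub>" "(act a ^^ n) y' = \<zero>\<^bsub>Y\<^esub>" by blast
    then have "(act a ^^ max m n) y = \<zero>\<^bsub>Y\<^esub>" "(act a ^^ max m n) y' = \<zero>\<^bsub>Y\<^esub>"
      using mono max.cobounded1 max.cobounded2 by blast+
    then have "(act a ^^ max m n) (y \<oplus>\<^bsub>Y\<^esub> y') = \<zero>\<^bsub>Y\<^esub>"
      using linD(2)[of y y'] MY_closed add by simp
    then show ?case ..
  next
    case (smult c y)
    then obtain m where "(act a ^^ m) y = \<zero>\<^bsub>Y\<^esub>" by blast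
    then have "(act a ^^ m) (c \<odot>\<^bsub>Y\<^esub> y) = \<zero>\<^bsub>Y\<^esub>"
      using linD(3)[of c y] MY_closed smult by simp
    then show ?case ..
  }
qed

text \<open>Elements of \<open>B\<close> are removed one at a time: \<open>lin_comb_kernel\<close>
  places the kernel of \<open>act b\<close> on the extension of \<open>annihilated C\<close> inside
  the extension of \<open>annihilated (insert b C)\<close>, and \<open>dcc_on_kernel\<close> lifts
  the chain condition from that kernel.\<close>

lemma dcc_on_ext_annihilated:
  assumes "finite B" "B \<subseteq> G" "C \<subseteq> G" and G: "G \<subseteq> carrier R"
    and nil: "\<And>a x. a \<in> G \<Longrightarrow> x \<in> carrier M \<Longrightarrow> \<exists>k::nat. (a [^]\<^bsub>R\<^esub> k) \<odot>\<^bsub>M\<^esub> x = \<zero>\<^bsub>M\<^esub>"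
    and "dcc_on L Y (act ` G) (scalar_ext (annihilated (C \<union> B)))"
  shows "dcc_on L Y (act ` G) (scalar_ext (annihilated C))"
  using assms(1,2,3,6)
proof (induction B arbitrary: C rule: finite_induct)
  case empty
  then show ?case by simp
next
  case (insert b B)
  have b: "b \<in> G" "b \<in> carrier R" using insert.prems G by auto
  have CR: "C \<subseteq> carrier R" using insert.prems G by blast
  have "dcc_on L Y (act ` G) (scalar_ext (annihilated (insert b C)))"
    by (rule insert.IH) (use insert.prems in auto)
  moreover have "annihilated (insert b C) = {x \<in> annihilated C. b \<odot>\<^bsub>M\<^esub> x = \<zero>\<^bsub>M\<^esub>}"
    unfolding annihilated_def by blast
  moreover have "{y \<in> scalar_ext (annihilated C). act b y = \<zero>\<^bsub>Y\<^esub>} \<subseteq> scalar_ext {x \<in> annihilated C. b \<odot>\<^bsub>M\<^esub> x = \<zero>\<^bsub>M\<^esub>}"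
    using lin_comb_kernel[OF annihilated_submodule[OF CR] b(2)] unfolding scalar_ext_def[of "annihilated C"] by blast
  ultimately have ker: "dcc_on L Y (act ` G) {y \<in> scalar_ext (annihilated C). act b y = \<zero>\<^bsub>Y\<^esub>}"
    using dcc_on_mono[OF _ order_refl] by metis
  have sub: "y \<in> MY" if "y \<in> scalar_ext (annihilated C)" for y
    using that ext_mono[OF annihilated_carrier] by blast
  show ?case
  proof (rule Y.dcc_on_kernel[OF _ _ _ _ _ ker])
    show "submodule (scalar_ext (annihilated C)) L Y" by (rule ext_submodule[OF annihilated_carrier])
    show "act b \<in> act ` G" using b by blast
    show "linear_on L Y (scalar_ext (annihilated C)) \<psi>" if "\<psi> \<in> act ` G" for \<psi>
      using that G annihilated_smult[OF CR] act_linear_ext[OF annihilated_carrier] by blast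
    show "\<psi> (act b y) = act b (\<psi> y)" if "\<psi> \<in> act ` G" "y \<in> scalar_ext (annihilated C)" for \<psi> y
      using that G act_commute b(2) sub by blast
    show "\<exists>k. (act b ^^ k) y = \<zero>\<^bsub>Y\<^esub>" if "y \<in> scalar_ext (annihilated C)" for y
      using act_locally_nilpotent[OF b(2) nil[OF b(1)] sub[OF that]] .
  qed
qed

text \<open>The common annihilator of \<open>G\<close> is finite dimensional over \<open>K\<close>,
  so its extension lies in a finite-dimensional \<open>L\<close>-space; from there the condition is
  lifted by removing the elements of \<open>G\<close> one by one.\<close>

lemma dcc_on_MY:
  assumes fin: "finite G" and G: "G \<subseteq> carrier R"
    and nil: "\<And>a x. a \<in> G \<Longrightarrow> x \<in> carrier M \<Longrightarrow> \<exists>k::nat. (a [^]\<^bsub>R\<^esub> k) \<odot>\<^bsub>M\<^esub> x = \<zero>\<^bsub>M\<^esub>"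
    and dcc: "dcc_on (R\<lparr>carrier := K\<rparr>) M {} (annihilated G)"
  shows "dcc_on L Y (act ` G) MY"
proof -
  from M.finite_generation_of_dcc[OF subfield_K annihilated_submodule[OF G] dcc]
  obtain A where A0: "finite A \<and> A \<subseteq> annihilated G \<and>
    (\<forall>W. submodule W (R\<lparr>carrier := K\<rparr>) M \<and> A \<subseteq> W \<longrightarrow> annihilated G \<subseteq> W)" ..
  then have A: "finite A" "A \<subseteq> annihilated G"
    "\<And>W. submodule W (R\<lparr>carrier := K\<rparr>) M \<Longrightarrow> A \<subseteq> W \<Longrightarrow> annihilated G \<subseteq> W" by simp_all
  have AM: "A \<subseteq> carrier M" using A(2) annihilated_carrier by blast
  obtain U where U: "submodule U L Y" "\<iota> ` A \<subseteq> U" "dcc_on L Y {} U"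
    using Y.dcc_on_finite_span[OF field_L, of "\<iota> ` A"] A(1) AM \<iota>_closed by blast
  \<comment> \<open>Generation by \<open>A\<close> is tested against the preimage of
    \<open>U\<close>, a \<open>K\<close>-subspace containing \<open>A\<close>.\<close>
  have "submodule {x \<in> carrier M. \<iota> x \<in> U} (R\<lparr>carrier := K\<rparr>) M"
    by (rule N.submoduleI')
      (use Y.submodule_zero[OF U(1)] Y.submoduleE(4,5)[OF U(1)] \<iota>_zero \<iota>_add \<iota>_smult KR h_closed in auto)
  then have "annihilated G \<subseteq> {x \<in> carrier M. \<iota> x \<in> U}"
    by (rule A(3)) (use AM U(2) in blast)
  then have "scalar_ext (annihilated G) \<subseteq> U" using ext_least[OF U(1)] by blast
  then have "dcc_on L Y (act ` G) (scalar_ext (annihilated ({} \<union> G)))"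
    using dcc_on_mono[OF U(3)] by simp
  then have "dcc_on L Y (act ` G) (scalar_ext (annihilated {}))"
    using dcc_on_ext_annihilated[OF fin _ _ G nil, of "{}"] by blast
  moreover have "annihilated {} = carrier M" unfolding annihilated_def by simp
  ultimately show ?thesis by simp
qed

section \<open>The stable part inside the base change\<close>

lemma ex_p_pow_root:
  assumes "c \<in> carrier L" shows "\<exists>d\<in>carrier L. d [^]\<^bsub>L\<^esub> (p ^ n) = c"
proof (induction n)
  case 0
  show ?case using assms by simp
next
  case (Suc n)
  then obtain d where d: "d \<in> carrier L" "d [^]\<^bsub>L\<^esub> (p ^ n) = c" by blast
  obtain e where e: "e \<in> carrier L" "e [^]\<^bsub>L\<^esub> p = d" using perfect[OF d(1)] by blast
  have "e [^]\<^bsub>L\<^esub> (p ^ Suc n) = c" using d e by (simp add: Y.R.nat_pow_pow[symmetric])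
  then show ?case using e by blast
qed

text \<open>The image of \<open>F'^j\<close> is closed under scalars that have \<open>p^j\<close>-th
  roots. Over the perfect field \<open>L\<close> it is therefore a subspace, so even elements of the
  span become actual \<open>j\<close>-fold images.\<close>

lemma span_F_pow:
  assumes "y \<in> subspace_span K R M ((F ^^ j) ` carrier M)"
  shows "y \<in> carrier M" and "\<exists>z\<in>MY. \<iota> y = (F' ^^ j) z"
proof -
  have \<iota>M: "\<iota> x \<in> MY" if "x \<in> carrier M" for x using \<iota>_in_ext[OF order_refl that] .
  have "submodule {x \<in> carrier M. \<exists>z\<in>MY. \<iota> x = (F' ^^ j) z} (R\<lparr>carrier := K\<rparr>) M" (is "submodule ?W _ _")
  proof (rule N.submoduleI')
    have "\<iota> \<zero>\<^bsub>M\<^esub> = (F' ^^ j) \<zero>\<^bsub>Y\<^esub>" by (simp add: \<iota>_zero F'_pow_zero)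
    then show "\<zero>\<^bsub>M\<^esub> \<in> ?W" using Y.submodule_zero[OF MY_submodule] by blast
  next
    fix x x' assume "x \<in> ?W" "x' \<in> ?W"
    then obtain z z' where z: "x \<in> carrier M" "x' \<in> carrier M" "z \<in> MY" "z' \<in> MY"
      "\<iota> x = (F' ^^ j) z" "\<iota> x' = (F' ^^ j) z'" by blast
    then have "\<iota> (x \<oplus>\<^bsub>M\<^esub> x') = (F' ^^ j) (z \<oplus>\<^bsub>Y\<^esub> z')"
      by (simp add: \<iota>_add F'_pow_add MY_closed)
    then show "x \<oplus>\<^bsub>M\<^esub> x' \<in> ?W" using Y.submoduleE(5)[OF MY_submodule z(3,4)] z(1,2) by blast
  next
    fix a x assume a: "a \<in> carrier (R\<lparr>carrier := K\<rparr>)" and "x \<in> ?W"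
    then obtain z where z: "x \<in> carrier M" "z \<in> MY" "\<iota> x = (F' ^^ j) z" by blast
    have aK: "a \<in> K" using a by simp
    obtain d where d: "d \<in> carrier L" "d [^]\<^bsub>L\<^esub> (p ^ j) = h a"
      using ex_p_pow_root h_closed[OF aK] by blast
    have "\<iota> (a \<odot>\<^bsub>M\<^esub> x) = (F' ^^ j) (d \<odot>\<^bsub>Y\<^esub> z)"
      using z d \<iota>_smult[OF aK z(1)] by (simp add: F'_pow_smult MY_closed)
    then show "a \<odot>\<^bsub>M\<^esub> x \<in> ?W" using Y.submoduleE(4)[OF MY_submodule d(1) z(2)] z(1) aK KR by blast
  qed blast
  moreover have "(F ^^ j) ` carrier M \<subseteq> ?W"
  proof (rule image_subsetI)
    fix x assume x: "x \<in> carrier M"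
    then show "(F ^^ j) x \<in> ?W"
      using F_pow_closed[OF x] F'_pow_\<iota>[OF x, symmetric] \<iota>M[OF x] by blast
  qed
  ultimately have "y \<in> ?W" using assms unfolding subspace_span_def by blast
  then show "y \<in> carrier M" and "\<exists>z\<in>MY. \<iota> y = (F' ^^ j) z" by blast+
qed

text \<open>The finitely many levels in \<open>D n\<close> can be met by a sufficiently deep
  preimage \<open>z\<close> of \<open>\<iota> y\<close>; stability of the chain then supplies the
  condition at level \<open>j\<close>, which concerns \<open>y\<close> itself.\<close>

lemma stable_part_annihilated:
  assumes fin: "finite G" and G: "G \<subseteq> carrier R" and p: "1 < p"
    and nil: "\<And>a x. a \<in> G \<Longrightarrow> x \<in> carrier M \<Longrightarrow> \<exists>k::nat. (a [^]\<^bsub>R\<^esub> k) \<odot>\<^bsub>M\<^esub> x = \<zero>\<^bsub>M\<^esub>"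
    and dcc: "dcc_on (R\<lparr>carrier := K\<rparr>) M {} (annihilated G)"
    and y: "y \<in> stable_part K R M F"
  shows "y \<in> annihilated G"
proof -
  define D where "D e = {z \<in> MY. \<forall>a\<in>G. \<forall>i\<le>e. act a ((F' ^^ i) z) \<in> nilpotents}" for e
  have GR: "a \<in> carrier R" if "a \<in> G" for a using that G by blast
  note nilE = Y.submoduleE[OF nilpotents_submodule]
  have D_sub: "submodule (D e) L Y" for e
  proof (rule Y.submoduleI')
    show "D e \<subseteq> carrier Y" unfolding D_def using MY_closed by blast
    show "\<zero>\<^bsub>Y\<^esub> \<in> D e" unfolding D_def
      using Y.submodule_zero[OF MY_submodule] Y.submodule_zero[OF nilpotents_submodule] GR
      by (simp add: F'_pow_zero act_zero)
  next
    fix x x' assume *: "x \<in> D e" "x' \<in> D e"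
    then have "x \<in> MY" "x' \<in> MY" unfolding D_def by blast+
    then show "x \<oplus>\<^bsub>Y\<^esub> x' \<in> D e" using * Y.submoduleE(5)[OF MY_submodule] nilE(5) GR
      unfolding D_def by (auto simp: F'_pow_add act_add MY_closed F'_pow_closed)
  next
    fix c x assume c: "c \<in> carrier L" and *: "x \<in> D e"
    then have "x \<in> MY" unfolding D_def by blast+
    then show "c \<odot>\<^bsub>Y\<^esub> x \<in> D e" using c * Y.submoduleE(4)[OF MY_submodule] nilE(4) GR
      unfolding D_def by (auto simp: F'_pow_smult act_smult MY_closed F'_pow_closed)
  qed
  have D_act: "act b z \<in> D e" if b: "b \<in> carrier R" and z: "z \<in> D e" for b z e
  proof -
    have zM: "z \<in> MY" using z unfolding D_def by blast
    have "act a ((F' ^^ i) (act b z)) \<in> nilpotents" if a: "a \<in> G" and i: "i \<le> e" for a i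
    proof -
      \<comment> \<open>Moving \<open>F'^i\<close> past \<open>act b\<close> replaces
        \<open>b\<close> by a power, and the resulting operator commutes with \<open>act a\<close>
        and preserves nilpotents.\<close>
      have "act a ((F' ^^ i) (act b z)) = act (b [^]\<^bsub>R\<^esub> (p ^ i)) (act a ((F' ^^ i) z))"
        using act_commute F'_pow_act[OF b zM] F'_pow_MY[OF zM] GR[OF a] b by simp
      then show ?thesis using act_nilpotents z a i b unfolding D_def by simp
    qed
    then show ?thesis unfolding D_def using act_MY[OF b zM] by blast
  qed
  have "\<exists>n. \<forall>i\<ge>n. D i = D n"
  proof (rule dcc_onD[OF dcc_on_MY[OF fin G nil dcc]])
    show "submodule (D i) L Y" for i by (rule D_sub)
    show "D i \<subseteq> MY" for i unfolding D_def by blast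
    show "\<phi> x \<in> D i" if "\<phi> \<in> act ` G" "x \<in> D i" for i \<phi> x using that D_act GR by blast
    show "D (Suc i) \<subseteq> D i" for i unfolding D_def by auto
  qed
  then obtain n where n: "\<And>i. i \<ge> n \<Longrightarrow> D i = D n" by blast
  have y_span: "y \<in> subspace_span K R M ((F ^^ j) ` carrier M)" if "1 \<le> j" for j
    using y that unfolding stable_part_def by simp
  have yM: "y \<in> carrier M" using span_F_pow(1)[OF y_span] by blast
  \<comment> \<open>Finiteness of \<open>G\<close> gives one exponent for all its elements; the sum
    of the individual exponents is a bound for each.\<close>
  have "\<exists>k::nat. \<forall>a\<in>G. (a [^]\<^bsub>R\<^esub> k) \<odot>\<^bsub>M\<^esub> y = \<zero>\<^bsub>M\<^esub>"
  proof -
    have "\<forall>a\<in>G. \<exists>k::nat. (a [^]\<^bsub>R\<^esub> k) \<odot>\<^bsub>M\<^esub> y = \<zero>\<^bsub>M\<^esub>" using nil yM by blast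
    then obtain \<kappa> where \<kappa>: "\<And>a. a \<in> G \<Longrightarrow> (a [^]\<^bsub>R\<^esub> (\<kappa> a :: nat)) \<odot>\<^bsub>M\<^esub> y = \<zero>\<^bsub>M\<^esub>" by metis
    have "(a [^]\<^bsub>R\<^esub> sum \<kappa> G) \<odot>\<^bsub>M\<^esub> y = \<zero>\<^bsub>M\<^esub>" if a: "a \<in> G" for a
    proof -
      have "sum \<kappa> G = sum \<kappa> (G - {a}) + \<kappa> a" using sum.remove[OF fin a, of \<kappa>] by simp
      then have "a [^]\<^bsub>R\<^esub> sum \<kappa> G = (a [^]\<^bsub>R\<^esub> sum \<kappa> (G - {a})) \<otimes>\<^bsub>R\<^esub> (a [^]\<^bsub>R\<^esub> \<kappa> a)"
        using GR[OF a] by (simp add: M.R.nat_pow_mult)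
      then show ?thesis using GR[OF a] \<kappa>[OF a] yM by (simp add: M.smult_assoc1)
    qed
    then show ?thesis by blast
  qed
  then obtain k :: nat where k: "\<And>a. a \<in> G \<Longrightarrow> (a [^]\<^bsub>R\<^esub> k) \<odot>\<^bsub>M\<^esub> y = \<zero>\<^bsub>M\<^esub>" by blast
  \<comment> \<open>Chosen so that \<open>j - i \<ge> k\<close> for every \<open>i \<le> n\<close>,
    that \<open>j \<ge> n\<close>, and that \<open>j \<ge> 1\<close>, the first index occurring in
    the stable part.\<close>
  define j where "j = Suc (k + n)"
  obtain z where z: "z \<in> MY" "\<iota> y = (F' ^^ j) z"
    using span_F_pow(2)[OF y_span, of j] unfolding j_def by auto
  have "z \<in> D n" unfolding D_def
  proof (intro CollectI conjI ballI allI impI)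
    fix a i assume a: "a \<in> G" and i: "i \<le> n"
    have ij: "i \<le> j" "k \<le> j - i" using i unfolding j_def by auto
    have "k \<le> p ^ (j - i)" using ij(2) power_gt_expt[of p "j - i"] p by linarith
    then have "a [^]\<^bsub>R\<^esub> (p ^ (j - i)) = (a [^]\<^bsub>R\<^esub> (p ^ (j - i) - k)) \<otimes>\<^bsub>R\<^esub> (a [^]\<^bsub>R\<^esub> k)"
      using GR[OF a] by (simp add: M.R.nat_pow_mult)
    then have ay: "(a [^]\<^bsub>R\<^esub> (p ^ (j - i))) \<odot>\<^bsub>M\<^esub> y = \<zero>\<^bsub>M\<^esub>"
      using GR[OF a] k[OF a] yM by (simp add: M.smult_assoc1)
    \<comment> \<open>The remaining \<open>j - i\<close> iterations turn \<open>F'^i z\<close> into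
      \<open>\<iota> y\<close> and raise \<open>a\<close> to the power
      \<open>p^(j - i) \<ge> k\<close>, which kills \<open>y\<close>.\<close>
    have "(F' ^^ (j - i)) (act a ((F' ^^ i) z)) = act (a [^]\<^bsub>R\<^esub> (p ^ (j - i))) ((F' ^^ (j - i)) ((F' ^^ i) z))"
      by (rule F'_pow_act[OF GR[OF a] F'_pow_MY[OF z(1)]])
    also have "(F' ^^ (j - i)) ((F' ^^ i) z) = \<iota> y"
      unfolding z(2) using ij(1) by (metis comp_apply funpow_add le_add_diff_inverse2)
    also have "act (a [^]\<^bsub>R\<^esub> (p ^ (j - i))) (\<iota> y) = \<zero>\<^bsub>Y\<^esub>"
      using act_\<iota>[OF _ yM, of "a [^]\<^bsub>R\<^esub> (p ^ (j - i))"] ay GR[OF a] by (simp add: \<iota>_zero)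
    finally show "act a ((F' ^^ i) z) \<in> nilpotents"
      unfolding nilpotents_def using act_MY[OF GR[OF a] F'_pow_MY[OF z(1)]] by blast
  qed (rule z(1))
  \<comment> \<open>Stability extends the conditions from levels up to \<open>n\<close> to levels up
    to \<open>j\<close>, where the iterate of \<open>z\<close> is \<open>\<iota> y\<close>.\<close>
  then have zD: "z \<in> D j" using n[of j] unfolding j_def by simp
  have "a \<odot>\<^bsub>M\<^esub> y = \<zero>\<^bsub>M\<^esub>" if a: "a \<in> G" for a
  proof -
    have "act a (\<iota> y) \<in> nilpotents" using zD a unfolding D_def z(2) by blast
    then obtain m where "(F' ^^ m) (\<iota> (a \<odot>\<^bsub>M\<^esub> y)) = \<zero>\<^bsub>Y\<^esub>"
      unfolding nilpotents_def using act_\<iota>[OF GR[OF a] yM] by auto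
    moreover have ay: "a \<odot>\<^bsub>M\<^esub> y \<in> carrier M" using GR[OF a] yM by simp
    \<comment> \<open>Back in \<open>M\<close> nilpotence means vanishing, because
      \<open>\<iota>\<close> has trivial kernel and \<open>F\<close> is injective.\<close>
    ultimately have "\<iota> ((F ^^ m) (a \<odot>\<^bsub>M\<^esub> y)) = \<zero>\<^bsub>Y\<^esub>" by (simp add: F'_pow_\<iota>)
    then have "(F ^^ m) (a \<odot>\<^bsub>M\<^esub> y) = \<zero>\<^bsub>M\<^esub>" using \<iota>_eq_zeroD F_pow_closed[OF ay] by blast
    then show ?thesis using F_pow_eq_zeroD[OF ay] by blast
  qed
  then show ?thesis unfolding annihilated_def using yM by blast
qed

end

subsection \<open>Existence of the base change\<close>

lemma (in cring) binomial:
  assumes x: "x \<in> carrier R" and y: "y \<in> carrier R"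
  shows "(x \<oplus> y) [^] n = (\<Oplus>k\<in>{..n}. [(n choose k)] \<cdot> (x [^] k \<otimes> y [^] (n - k)))"
proof (induction n)
  case 0
  show ?case using assms by simp
next
  case (Suc n)
  define m where "m k = x [^] k \<otimes> y [^] (Suc n - k)" for k
  have m: "m k \<in> carrier R" for k using assms by (simp add: m_def)
  have x_part: "([(n choose k)] \<cdot> (x [^] k \<otimes> y [^] (n - k))) \<otimes> x = [(n choose k)] \<cdot> m (Suc k)" for k
    using assms by (simp add: add_pow_ldistr) (simp add: m_def m_ac)
  have y_part: "([(n choose k)] \<cdot> (x [^] k \<otimes> y [^] (n - k))) \<otimes> y = [(n choose k)] \<cdot> m k" if "k \<le> n" for k
    using assms that by (simp add: add_pow_ldistr) (simp add: m_def m_ac Suc_diff_le)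
  have "(x \<oplus> y) [^] Suc n
    = (\<Oplus>k\<in>{..n}. [(n choose k)] \<cdot> (x [^] k \<otimes> y [^] (n - k))) \<otimes> x \<oplus>
      (\<Oplus>k\<in>{..n}. [(n choose k)] \<cdot> (x [^] k \<otimes> y [^] (n - k))) \<otimes> y"
    using assms by (simp add: Suc r_distr)
  also have "\<dots> = (\<Oplus>k\<in>{..n}. [(n choose k)] \<cdot> m (Suc k)) \<oplus> (\<Oplus>k\<in>{..n}. [(n choose k)] \<cdot> m k)"
    using assms m x_part y_part
    by (intro arg_cong2[of _ _ _ _ "(\<oplus>)"]) (auto simp: finsum_ldistr Pi_def intro!: finsum_cong')
  \<comment> \<open>The added term has coefficient \<open>n choose Suc n\<close>, which is zero.
    Splitting off \<open>m 0\<close> afterwards aligns both sums on \<open>m (Suc k)\<close>, ready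
    for Pascal's rule.\<close>
  also have "(\<Oplus>k\<in>{..n}. [(n choose k)] \<cdot> m k) = (\<Oplus>k\<in>{..Suc n}. [(n choose k)] \<cdot> m k)"
    using m by (simp add: Pi_def binomial_eq_0)
  also have "\<dots> = (\<Oplus>k\<in>{..n}. [(n choose Suc k)] \<cdot> m (Suc k)) \<oplus> m 0"
    using m by (subst finsum_Suc2) (auto simp: Pi_def)
  also have "(\<Oplus>k\<in>{..n}. [(n choose k)] \<cdot> m (Suc k)) \<oplus> ((\<Oplus>k\<in>{..n}. [(n choose Suc k)] \<cdot> m (Suc k)) \<oplus> m 0)
    = (\<Oplus>k\<in>{..n}. [(n choose k)] \<cdot> m (Suc k) \<oplus> [(n choose Suc k)] \<cdot> m (Suc k)) \<oplus> m 0"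
    using m by (simp add: finsum_addf Pi_def a_assoc)
  also have "\<dots> = (\<Oplus>k\<in>{..n}. [(Suc n choose Suc k)] \<cdot> m (Suc k)) \<oplus> [(Suc n choose 0)] \<cdot> m 0"
    using m by (simp add: add.nat_pow_mult)
  also have "\<dots> = (\<Oplus>k\<in>{..Suc n}. [(Suc n choose k)] \<cdot> m k)"
    using m by (subst finsum_Suc2) (auto simp: Pi_def)
  finally show ?case unfolding m_def .
qed

text \<open>The inner binomial coefficients are divisible by \<open>p\<close>. The characteristic
  enters as the equation \<open>[p] \<cdot> \<one> = \<zero>\<close> because this form transfers
  along the homomorphism from \<open>K\<close> to \<open>L\<close>.\<close>

lemma (in cring) frobenius_add:
  assumes p: "Factorial_Ring.prime (p :: nat)" and char: "[p] \<cdot> \<one> = \<zero>"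
    and x: "x \<in> carrier R" and y: "y \<in> carrier R"
  shows "(x \<oplus> y) [^] p = x [^] p \<oplus> y [^] p"
proof -
  define f where "f k = [(p choose k)] \<cdot> (x [^] k \<otimes> y [^] (p - k))" for k
  have f: "f k \<in> carrier R" for k using assms by (simp add: f_def)
  have mult: "[(p * n)] \<cdot> z = \<zero>" if "z \<in> carrier R" for n z
  proof -
    have "[p] \<cdot> z = ([p] \<cdot> \<one>) \<otimes> z" using that by (simp add: add_pow_ldistr)
    then have "[p] \<cdot> z = \<zero>" using char that by simp
    then show ?thesis using that add.nat_pow_pow[of z n p] by simp
  qed
  have f0: "f k = \<zero>" if "0 < k" "k < p" for k
  proof -
    have "p dvd p choose k" using that p dvd_choose_prime[of k p] by simp
    then obtain n where "p choose k = p * n" by blast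
    then show ?thesis using mult assms by (simp add: f_def)
  qed
  \<comment> \<open>Exposing two successors lets the sum be split into the terms for
    \<open>p\<close> and \<open>0\<close> and the inner terms \<open>Suc k\<close> with
    \<open>k \<le> r\<close>.\<close>
  obtain r where r: "p = Suc (Suc r)" using prime_ge_2_nat[OF p] by (metis Suc_le_D numeral_2_eq_2 le_Suc_ex add_Suc)
  have "(x \<oplus> y) [^] p = (\<Oplus>k\<in>{..Suc (Suc r)}. f k)"
    using binomial[OF x y, of p] r unfolding f_def by simp
  also have "\<dots> = f p \<oplus> (\<Oplus>k\<in>{..Suc r}. f k)" using f r by (simp add: Pi_def)
  also have "(\<Oplus>k\<in>{..Suc r}. f k) = (\<Oplus>k\<in>{..r}. f (Suc k)) \<oplus> f 0"
    using f by (subst finsum_Suc2) (auto simp: Pi_def)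
  also have "(\<Oplus>k\<in>{..r}. f (Suc k)) = (\<Oplus>k\<in>{..r}. \<zero>)"
    using f0 r by (intro finsum_cong') auto
  finally show ?thesis using x y f by (simp add: f_def)
qed

lemma (in cring) frobenius_pow_add:
  assumes "Factorial_Ring.prime (p :: nat)" "[p] \<cdot> \<one> = \<zero>" "x \<in> carrier R" "y \<in> carrier R"
  shows "(x \<oplus> y) [^] (p ^ e) = x [^] (p ^ e) \<oplus> y [^] (p ^ e)"
proof (induction e)
  case (Suc e)
  have "z [^] (p ^ Suc e) = (z [^] (p ^ e)) [^] p" if "z \<in> carrier R" for z
    using that by (simp add: nat_pow_pow mult.commute)
  then show ?case using Suc frobenius_add[OF assms(1,2)] assms(3,4) by simp
qed (use assms in simp)

text \<open>With \<open>n = p\<close> this supplies the perfectness required of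
  \<open>L\<close>.\<close>

lemma (in algebraically_closed) ex_root:
  assumes c: "c \<in> carrier L" and n: "0 < n"
  shows "\<exists>d\<in>carrier L. d [^] (n::nat) = c"
proof -
  \<comment> \<open>Coefficient lists start with the leading term, so appending an entry to the
    monomial of degree \<open>n - 1\<close> multiplies it by the variable and adds a constant:
    \<open>P\<close> is \<open>X^n - c\<close>.\<close>
  define P where "P = monom \<one> (n - 1) @ [\<ominus> c]"
  have P: "P \<in> carrier (poly_ring L)"
    using c by (auto simp: P_def monom_def sym[OF univ_poly_carrier] polynomial_def)
  have "degree P = n" using n by (simp add: P_def monom_def)
  then have "roots P \<noteq> {#}" using roots_over_carrier[OF P] n unfolding splitted_def by auto
  then obtain d where "is_root P d" using roots_mem_iff_is_root[OF P] by blast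
  then have d: "d \<in> carrier L" "eval P d = \<zero>" unfolding is_root_def by auto
  have "eval P d = (\<one> \<otimes> d [^] (n - 1)) \<otimes> d \<oplus> \<ominus> c"
    unfolding P_def using eval_append_aux[of "monom \<one> (n - 1)" "\<ominus> c" d] monom_in_carrier[of \<one> "n - 1"] eval_monom[of \<one> d "n - 1"] c d(1)
    by simp
  then have "eval P d = d [^] n \<ominus> c" using d(1) n by (cases n) (simp_all add: a_minus_def)
  then have "d [^] n \<ominus> c = \<zero>" using d(2) by (rule trans[OF sym])
  then have "d [^] n = c" using d(1) c by simp
  then show ?thesis using d by blast
qed

text \<open>
  The base change \<open>L \<otimes>\<^sub>K M\<close> is realised as the \<open>L\<close>-span of the functions
  \<open>(e, f) \<mapsto> h (f (F\<^sup>e x))\<close>, where \<open>f\<close> ranges over the \<open>K\<close>-linear functionals on \<open>M\<close>. With scalars acting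
  through \<open>c\<^bsup>p^e\<^esup>\<close> in the coordinates \<open>(e, f)\<close>, the Frobenius action becomes the shift \<open>e \<mapsto> e + 1\<close>.
\<close>

definition twisted_functions :: "nat \<Rightarrow> ('l, 'e) ring_scheme \<Rightarrow> ('l, nat \<times> 'i \<Rightarrow> 'l) module" where
  "twisted_functions p L = \<lparr>carrier = UNIV \<rightarrow> carrier L, monoid.mult = undefined, one = undefined,
     ring.zero = \<lambda>_. \<zero>\<^bsub>L\<^esub>, ring.add = \<lambda>g g' t. g t \<oplus>\<^bsub>L\<^esub> g' t,
     smult = \<lambda>c g t. (c [^]\<^bsub>L\<^esub> (p ^ fst t)) \<otimes>\<^bsub>L\<^esub> g t\<rparr>"

text \<open>Characteristic \<open>p\<close> enters in distributivity over a sum of scalars: the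
  twist \<open>c^(p^e)\<close> has to be additive in \<open>c\<close>.\<close>

lemma (in cring) module_twisted_functions:
  assumes "Factorial_Ring.prime (p :: nat)" "[p] \<cdot> \<one> = \<zero>"
  shows "module R (twisted_functions p R :: ('a, nat \<times> 'i \<Rightarrow> 'a) module)" (is "module R ?Y")
proof (rule moduleI)
  show "abelian_group ?Y"
  proof (rule abelian_groupI)
    fix g assume "g \<in> carrier ?Y"
    then show "\<exists>g'\<in>carrier ?Y. g' \<oplus>\<^bsub>?Y\<^esub> g = \<zero>\<^bsub>?Y\<^esub>"
      by (intro bexI[of _ "\<lambda>t. \<ominus> g t"]) (auto simp: twisted_functions_def Pi_iff l_neg)
  qed (auto simp: twisted_functions_def a_ac Pi_iff)
qed (use frobenius_pow_add[OF assms] in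
    \<open>auto simp: twisted_functions_def fun_eq_iff Pi_iff l_distr r_distr nat_pow_distrib m_assoc intro: is_cring\<close>)

lemma (in module) frobenius_base_change_exists:
  fixes L :: "('l, 'e) ring_scheme"
  assumes K: "subfield K R" and L: "algebraically_closed L" and h: "h \<in> ring_hom (R\<lparr>carrier := K\<rparr>) L"
    and p: "Factorial_Ring.prime (p :: nat)" and char: "[p] \<cdot> \<one> = \<zero>"
    and F: "frobenius_action p R M F" and F_inj: "inj_on F (carrier M)"
  shows "\<exists>(Y :: ('l, nat \<times> ('c \<Rightarrow> 'a) \<Rightarrow> 'l) module) \<iota> act F'. frobenius_base_change R M L Y K h \<iota> act p F F'"
proof -
  interpret KF: field "R\<lparr>carrier := K\<rparr>" using R.subfield_iff(2)[OF K] .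
  have KR: "K \<subseteq> carrier R" by (rule subfieldE(3)[OF K])
  have K1: "\<one> \<in> K" "\<zero> \<in> K" using KF.one_closed KF.zero_closed by simp_all
  have Kadd: "a \<oplus> b \<in> K" "a \<otimes> b \<in> K" if "a \<in> K" "b \<in> K" for a b
    using subringE(6,7)[OF subfieldE(1)[OF K]] that by auto
  interpret L: algebraically_closed L by (rule L)
  have h1: "h \<one> = \<one>\<^bsub>L\<^esub>" using ring_hom_one[OF h] by simp
  have hcl: "h c \<in> carrier L" if "c \<in> K" for c using ring_hom_closed[OF h] that by simp
  have hadd: "h (c \<oplus> d) = h c \<oplus>\<^bsub>L\<^esub> h d" "h (c \<otimes> d) = h c \<otimes>\<^bsub>L\<^esub> h d" if "c \<in> K" "d \<in> K" for c d
    using ring_hom_add[OF h] ring_hom_mult[OF h] that by simp_all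
  have h0: "h \<zero> = \<zero>\<^bsub>L\<^esub>"
  proof -
    have "h \<zero> \<oplus>\<^bsub>L\<^esub> h \<zero> = h \<zero>" using hadd(1)[of \<zero> \<zero>] K1 by simp
    then show ?thesis using hcl K1 by simp
  qed
  have hpow: "c [^] (n::nat) \<in> K \<and> h (c [^] n) = h c [^]\<^bsub>L\<^esub> n" if "c \<in> K" for c n
    using that by (induction n) (simp_all add: K1 h1 hadd Kadd)
  have "[n] \<cdot> \<one> \<in> K \<and> h ([n] \<cdot> \<one>) = [n] \<cdot>\<^bsub>L\<^esub> \<one>\<^bsub>L\<^esub>" for n :: nat
    by (induction n) (simp_all add: K1 h0 h1 hadd Kadd)
  then have charL: "[p] \<cdot>\<^bsub>L\<^esub> \<one>\<^bsub>L\<^esub> = \<zero>\<^bsub>L\<^esub>" using char h0 by metis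
  let ?D = "functionals K R M"
  let ?Y = "twisted_functions p L"
  \<comment> \<open>The index type contains all maps \<open>'c \<Rightarrow> 'a\<close>; coordinates
    at maps that are not functionals are set to zero.\<close>
  define \<iota> where "\<iota> x = (\<lambda>t. if snd t \<in> ?D then h (snd t ((F ^^ fst t) x)) else \<zero>\<^bsub>L\<^esub>)" for x
  \<comment> \<open>Since \<open>F^e (a x) = a^(p^e) F^e x\<close>, multiplication by
    \<open>a\<close> amounts to precomposing the functional in coordinate \<open>(e, f)\<close> with
    multiplication by \<open>a^(p^e)\<close>.\<close>
  define act where "act a g = (\<lambda>t. if snd t \<in> ?D then g (fst t, \<lambda>x. snd t ((a [^] (p ^ fst t)) \<odot>\<^bsub>M\<^esub> x)) else \<zero>\<^bsub>L\<^esub>)"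
    for a :: 'a and g :: "nat \<times> ('c \<Rightarrow> 'a) \<Rightarrow> 'l"
  define F' where "F' g = (\<lambda>t. g (Suc (fst t), snd t))" for g :: "nat \<times> ('c \<Rightarrow> 'a) \<Rightarrow> 'l"
  note Fp = frobenius_action_funpow[OF F]
  have comp: "(\<lambda>x. f (b \<odot>\<^bsub>M\<^esub> x)) \<in> ?D" if "f \<in> ?D" "b \<in> carrier R" for f b
  proof -
    have "b \<odot>\<^bsub>M\<^esub> (c \<odot>\<^bsub>M\<^esub> x) = c \<odot>\<^bsub>M\<^esub> (b \<odot>\<^bsub>M\<^esub> x)" if "c \<in> K" "x \<in> carrier M" for c x
      using smult_assoc1[of b c x] smult_assoc1[of c b x] R.m_comm[of b c] that \<open>b \<in> carrier R\<close> KR by auto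
    then show ?thesis using that KR functionalsD[OF that(1)]
      unfolding functionals_def by (auto simp: smult_r_distr subset_iff)
  qed
  interpret Y: module L ?Y by (rule L.module_twisted_functions[OF p charL])
  have "frobenius_base_change R M L ?Y K h \<iota> act p F F'"
  proof (intro frobenius_base_change.intro frobenius_base_change_axioms.intro)
    show "module R M" ..
    show "module L ?Y" ..
    show "field L" ..
    show "\<exists>d\<in>carrier L. d [^]\<^bsub>L\<^esub> p = c" if "c \<in> carrier L" for c
      by (rule L.ex_root[OF that prime_gt_0_nat[OF p]])
    show "\<iota> x \<in> carrier ?Y" if "x \<in> carrier M" for x
      using that Fp(1) functionalsD(1)[of _ K R M] hcl
      by (auto simp: \<iota>_def twisted_functions_def fun_eq_iff)
    show "\<iota> (x \<oplus>\<^bsub>M\<^esub> x') = \<iota> x \<oplus>\<^bsub>?Y\<^esub> \<iota> x'" if "x \<in> carrier M" "x' \<in> carrier M" for x x'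
    proof
      fix t
      show "\<iota> (x \<oplus>\<^bsub>M\<^esub> x') t = (\<iota> x \<oplus>\<^bsub>?Y\<^esub> \<iota> x') t"
      proof (cases "snd t \<in> ?D")
        case True
        then show ?thesis using that Fp(1,2) functionalsD[OF True] hadd
          by (simp add: \<iota>_def twisted_functions_def)
      qed (simp add: \<iota>_def twisted_functions_def)
    qed
    \<comment> \<open>The twist in the scalar multiplication of \<open>?Y\<close> matches the factor
      \<open>c^(p^e)\<close> that \<open>F^e\<close> produces.\<close>
    show "\<iota> (c \<odot>\<^bsub>M\<^esub> x) = h c \<odot>\<^bsub>?Y\<^esub> \<iota> x" if "c \<in> K" "x \<in> carrier M" for c x
    proof
      fix t
      show "\<iota> (c \<odot>\<^bsub>M\<^esub> x) t = (h c \<odot>\<^bsub>?Y\<^esub> \<iota> x) t"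
      proof (cases "snd t \<in> ?D")
        case True
        then show ?thesis
          using that Fp(1,3) functionalsD[OF True] hadd hpow[OF that(1)] hcl[OF that(1)] KR
          by (simp add: \<iota>_def twisted_functions_def subset_iff)
      qed (use hcl[OF that(1)] in \<open>simp add: \<iota>_def twisted_functions_def\<close>)
    qed
    \<comment> \<open>The witness is evaluation at the coordinate \<open>(0, f)\<close>: there the
      twist is \<open>c^(p^0) = c\<close>, so evaluation is \<open>L\<close>-linear.\<close>
    show "\<exists>\<tau>. (\<forall>y\<in>carrier ?Y. \<tau> y \<in> carrier L) \<and>
        (\<forall>y\<in>carrier ?Y. \<forall>y'\<in>carrier ?Y. \<tau> (y \<oplus>\<^bsub>?Y\<^esub> y') = \<tau> y \<oplus>\<^bsub>L\<^esub> \<tau> y') \<and>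
        (\<forall>c\<in>carrier L. \<forall>y\<in>carrier ?Y. \<tau> (c \<odot>\<^bsub>?Y\<^esub> y) = c \<otimes>\<^bsub>L\<^esub> \<tau> y) \<and>
        (\<forall>x\<in>carrier M. \<tau> (\<iota> x) = h (f x))" if "f \<in> ?D" for f
      using that by (intro exI[of _ "\<lambda>g. g (0, f)"]) (auto simp: \<iota>_def twisted_functions_def)
    show "linear_on L ?Y (carrier ?Y) (act a)" if "a \<in> carrier R" for a
      using that by (auto simp: linear_on_def act_def twisted_functions_def fun_eq_iff Pi_iff)
    show "act a (\<iota> x) = \<iota> (a \<odot>\<^bsub>M\<^esub> x)" if "a \<in> carrier R" "x \<in> carrier M" for a x
      using that comp Fp(1,3) by (auto simp: \<iota>_def act_def fun_eq_iff)
    show "F' y \<in> carrier ?Y" if "y \<in> carrier ?Y" for y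
      using that by (auto simp: F'_def twisted_functions_def)
    show "F' (y \<oplus>\<^bsub>?Y\<^esub> y') = F' y \<oplus>\<^bsub>?Y\<^esub> F' y'" for y y'
      by (auto simp: F'_def twisted_functions_def)
    show "F' (c \<odot>\<^bsub>?Y\<^esub> y) = (c [^]\<^bsub>L\<^esub> p) \<odot>\<^bsub>?Y\<^esub> F' y" if "c \<in> carrier L" for c y
      using that by (auto simp: F'_def twisted_functions_def fun_eq_iff L.nat_pow_pow)
    show "F' (\<iota> x) = \<iota> (F x)" for x
      by (auto simp: F'_def \<iota>_def fun_eq_iff funpow_swap1)
  qed (use K h F F_inj in blast)+
  then show ?thesis by blast
qed

text \<open>Taking \<open>L\<close> to be an algebraic closure of \<open>K\<close> removes the base
  change from the statement; only data on \<open>R\<close>, \<open>K\<close> and \<open>M\<close>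
  remain.\<close>

lemma (in module) stable_part_subset:
  assumes K: "subfield K R" and p: "Factorial_Ring.prime (p :: nat)" and char: "[p] \<cdot> \<one> = \<zero>"
    and F: "frobenius_action p R M F" and F_inj: "inj_on F (carrier M)"
    and fin: "finite G" and G: "G \<subseteq> carrier R"
    and nil: "\<And>a x. a \<in> G \<Longrightarrow> x \<in> carrier M \<Longrightarrow> \<exists>k::nat. (a [^] k) \<odot>\<^bsub>M\<^esub> x = \<zero>\<^bsub>M\<^esub>"
    and dcc: "dcc_on (R\<lparr>carrier := K\<rparr>) M {} {x \<in> carrier M. \<forall>a\<in>G. a \<odot>\<^bsub>M\<^esub> x = \<zero>\<^bsub>M\<^esub>}"
  shows "stable_part K R M F \<subseteq> {x \<in> carrier M. \<forall>a\<in>G. a \<odot>\<^bsub>M\<^esub> x = \<zero>\<^bsub>M\<^esub>}"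
proof -
  interpret KF: field "R\<lparr>carrier := K\<rparr>" using R.subfield_iff(2)[OF K] .
  have "algebraic_closure KF.alg_closure (KF.indexed_const ` K)" using KF.alg_closureE(1) by simp
  then interpret L: algebraic_closure KF.alg_closure "KF.indexed_const ` K" .
  have "algebraically_closed KF.alg_closure" ..
  then obtain Y :: "(('a list \<times> nat) multiset \<Rightarrow> 'a, nat \<times> ('c \<Rightarrow> 'a) \<Rightarrow> ('a list \<times> nat) multiset \<Rightarrow> 'a) module"
    and \<iota> act F' where bc: "frobenius_base_change R M KF.alg_closure Y K KF.indexed_const \<iota> act p F F'"
    using frobenius_base_change_exists[OF K _ KF.alg_closureE(2) p char F F_inj] by blast
  show ?thesis
    using frobenius_base_change.stable_part_annihilated[OF bc fin G prime_gt_1_nat[OF p] nil]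
      frobenius_base_change.annihilated_def[OF bc] dcc
    by auto
qed

subsection \<open>Artinian modules over local rings\<close>

text \<open>A nonunit generates a proper ideal, which lies in a maximal one, and
  \<open>\<mm>\<close> is the only candidate.\<close>

lemma local_noetherian_Units:
  fixes R (structure)
  assumes "noetherian_ring R" "local_ring R \<mm>" and u: "u \<in> carrier R" "u \<notin> \<mm>"
  shows "u \<in> Units R"
proof (rule ccontr)
  interpret noetherian_ring R by fact
  interpret local_ring R \<mm> by fact
  assume nu: "u \<notin> Units R"
  define \<I> where "\<I> = {I. ideal I R \<and> u \<in> I \<and> \<one> \<notin> I}"
  have "\<one> \<notin> PIdl u"
  proof
    assume "\<one> \<in> PIdl u"
    then obtain v where v: "v \<in> carrier R" "\<one> = v \<otimes> u" unfolding cgenideal_def by blast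
    then show False using nu u(1) m_comm[of v u] unfolding Units_def by auto
  qed
  then have "PIdl u \<in> \<I>" using cgenideal_ideal cgenideal_self u(1) unfolding \<I>_def by blast
  then have "\<exists>J\<in>\<I>. \<forall>I\<in>\<I>. J \<subseteq> I \<longrightarrow> I = J"
  proof (intro subset_Zorn_nonempty)
    fix C assume C: "C \<noteq> {}" "subset.chain \<I> C"
    then have "subset.chain {I. ideal I R} C" unfolding \<I>_def subset.chain_def by auto
    \<comment> \<open>In a noetherian ring a nonempty chain of ideals contains its own union, so the
      union inherits membership in \<open>\<I>\<close>.\<close>
    then have "\<Union>C \<in> C" using ideal_chain_is_trivial C(1) by blast
    then show "\<Union>C \<in> \<I>" using C(2) unfolding subset.chain_def by blast
  qed blast
  then obtain J where J: "ideal J R" "u \<in> J" "\<one> \<notin> J" and max: "\<And>I. I \<in> \<I> \<Longrightarrow> J \<subseteq> I \<Longrightarrow> I = J"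
    unfolding \<I>_def by blast
  have "maximalideal J R"
  proof (rule maximalidealI)
    show "carrier R \<noteq> J" using J(3) by auto
    show "I = J \<or> I = carrier R" if "ideal I R" "J \<subseteq> I" for I
      using that max J(2) ideal.one_imp_carrier[OF that(1)] unfolding \<I>_def by blast
  qed (rule J(1))
  then show False using unique_maximal J(2) u(2) by blast
qed

text \<open>The chain of submodules \<open>R a^k x\<close> stabilises, so
  \<open>a^n x = r a^(n+1) x\<close> for some \<open>r\<close>. As \<open>1 - r a\<close> lies
  outside the maximal ideal it is a unit, and it kills \<open>a^n x\<close>.\<close>

lemma artinian_locally_nilpotent:
  fixes R (structure) and M :: "('a, 'b, 'd) module_scheme"
  assumes R: "noetherian_ring R" "local_ring R \<mm>" and M: "artinian_module R M"
    and a: "a \<in> \<mm>" and x: "x \<in> carrier M"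
  shows "\<exists>k::nat. (a [^] k) \<odot>\<^bsub>M\<^esub> x = \<zero>\<^bsub>M\<^esub>"
proof -
  interpret local_ring R \<mm> by fact
  interpret maximalideal \<mm> R by (rule maximal)
  interpret M: module R M using M unfolding artinian_module_def by blast
  have aR: "a \<in> carrier R" using a a_subset by blast
  define N where "N k = (\<lambda>r. r \<odot>\<^bsub>M\<^esub> ((a [^] k) \<odot>\<^bsub>M\<^esub> x)) ` carrier R" for k :: nat
  have sub: "submodule (N k) R M" for k
  proof (rule M.submoduleI')
    let ?y = "(a [^] k) \<odot>\<^bsub>M\<^esub> x"
    have y: "?y \<in> carrier M" using aR x by simp
    show "N k \<subseteq> carrier M" using y unfolding N_def by auto
    have "\<zero>\<^bsub>M\<^esub> = \<zero> \<odot>\<^bsub>M\<^esub> ?y" using y by simp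
    then show "\<zero>\<^bsub>M\<^esub> \<in> N k" unfolding N_def by (rule image_eqI) simp
    show "u \<oplus>\<^bsub>M\<^esub> v \<in> N k" if "u \<in> N k" "v \<in> N k" for u v
    proof -
      obtain r s where rs: "r \<in> carrier R" "s \<in> carrier R" "u = r \<odot>\<^bsub>M\<^esub> ?y" "v = s \<odot>\<^bsub>M\<^esub> ?y"
        using \<open>u \<in> N k\<close> \<open>v \<in> N k\<close> unfolding N_def by blast
      then have "u \<oplus>\<^bsub>M\<^esub> v = (r \<oplus> s) \<odot>\<^bsub>M\<^esub> ?y" using y by (simp add: M.smult_l_distr)
      then show ?thesis unfolding N_def by (rule image_eqI) (use rs in simp)
    qed
    show "r \<odot>\<^bsub>M\<^esub> u \<in> N k" if "r \<in> carrier R" "u \<in> N k" for r u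
    proof -
      obtain s where s: "s \<in> carrier R" "u = s \<odot>\<^bsub>M\<^esub> ?y" using \<open>u \<in> N k\<close> unfolding N_def by blast
      then have "r \<odot>\<^bsub>M\<^esub> u = (r \<otimes> s) \<odot>\<^bsub>M\<^esub> ?y" using y that(1) by (simp add: M.smult_assoc1)
      then show ?thesis unfolding N_def by (rule image_eqI) (use s that(1) in simp)
    qed
  qed
  have "N (Suc k) \<subseteq> N k" for k
  proof
    fix u assume "u \<in> N (Suc k)"
    then obtain r where r: "r \<in> carrier R" "u = r \<odot>\<^bsub>M\<^esub> ((a [^] Suc k) \<odot>\<^bsub>M\<^esub> x)" unfolding N_def by blast
    then have "u = (r \<otimes> a) \<odot>\<^bsub>M\<^esub> ((a [^] k) \<odot>\<^bsub>M\<^esub> x)"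
      using aR x by (simp add: M.smult_assoc1[symmetric] m_ac)
    then show "u \<in> N k" unfolding N_def by (rule image_eqI) (use r aR in simp)
  qed
  then obtain n where n: "\<And>i. i \<ge> n \<Longrightarrow> N i = N n"
    using M sub unfolding artinian_module_def by metis
  let ?y = "(a [^] n) \<odot>\<^bsub>M\<^esub> x"
  have y: "?y \<in> carrier M" using aR x by simp
  have "?y \<in> N n" unfolding N_def by (rule image_eqI[of _ _ \<one>]) (use y in simp_all)
  then have "?y \<in> N (Suc n)" using n[of "Suc n"] by simp
  then obtain r where r: "r \<in> carrier R" "?y = r \<odot>\<^bsub>M\<^esub> ((a [^] Suc n) \<odot>\<^bsub>M\<^esub> x)" unfolding N_def by blast
  define u where "u = \<one> \<ominus> r \<otimes> a"
  have uR: "u \<in> carrier R" using r aR unfolding u_def by simp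
  have ra: "r \<otimes> a \<in> \<mm>" using I_l_closed[OF a r(1)] .
  have "u \<notin> \<mm>"
  proof
    assume "u \<in> \<mm>"
    then have "u \<oplus> r \<otimes> a \<in> \<mm>" using ra by simp
    then have "\<one> \<in> \<mm>" using r aR unfolding u_def by (simp add: a_minus_def a_assoc l_neg)
    then show False using one_imp_carrier I_notcarr by blast
  qed
  then have "u \<in> Units R" using local_noetherian_Units[OF R uR] by blast
  then obtain v where v: "v \<in> carrier R" "v \<otimes> u = \<one>" unfolding Units_def by blast
  have "?y = (r \<otimes> a) \<odot>\<^bsub>M\<^esub> ?y"
    by (subst r(2)) (use r(1) aR x in \<open>simp add: M.smult_assoc1[symmetric] m_ac\<close>)
  then have "u \<odot>\<^bsub>M\<^esub> ?y = \<zero>\<^bsub>M\<^esub>"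
    using y r(1) aR unfolding u_def
    by (simp add: a_minus_def M.smult_l_distr M.smult_l_minus M.r_neg)
  then have "(v \<otimes> u) \<odot>\<^bsub>M\<^esub> ?y = \<zero>\<^bsub>M\<^esub>" using v(1) uR y by (simp add: M.smult_assoc1)
  then show ?thesis using v(2) y by auto
qed

text \<open>Surjectivity of the map from \<open>K\<close> to the residue field; through it the
  action of \<open>R\<close> on the socle reduces to that of \<open>K\<close>.\<close>

lemma coefficient_field_decomp:
  fixes R (structure)
  assumes "local_ring R \<mm>" "coefficient_field K R \<mm>" and r: "r \<in> carrier R"
  shows "\<exists>c\<in>K. \<exists>m\<in>\<mm>. r = m \<oplus> c"
proof -
  interpret local_ring R \<mm> by fact
  interpret maximalideal \<mm> R by (rule maximal)
  have "(\<lambda>x. \<mm> +> x) ` K = carrier (R Quot \<mm>)"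
    using assms(2) unfolding coefficient_field_def ring_iso_def bij_betw_def by simp
  moreover have "\<mm> +> r \<in> carrier (R Quot \<mm>)"
    using r unfolding FactRing_def A_RCOSETS_def' by auto
  ultimately obtain c where c: "c \<in> K" "\<mm> +> r = \<mm> +> c" by blast
  have "c \<in> carrier R" using c(1) assms(2) subfieldE(3) unfolding coefficient_field_def by blast
  then have "r \<in> \<mm> +> c" using c(2) a_rcos_self[OF r] by simp
  then show ?thesis using c(1) unfolding a_r_coset_def' by blast
qed

section \<open>Spans of iterates and invariance of the stable part\<close>

context module begin

lemma subspace_span_submodule:
  assumes K: "subfield K R" and A: "A \<subseteq> carrier M"
  shows "submodule (subspace_span K R M A) (R\<lparr>carrier := K\<rparr>) M"
proof -
  interpret N: module "R\<lparr>carrier := K\<rparr>" M by (rule module_restrict[OF K])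
  let ?\<V> = "{V. submodule V (R\<lparr>carrier := K\<rparr>) M \<and> A \<subseteq> V}"
  have c: "carrier M \<in> ?\<V>" using N.carrier_is_submodule A by blast
  show ?thesis unfolding subspace_span_def
  proof (rule N.submoduleI')
    show "\<Inter>?\<V> \<subseteq> carrier M" using c by blast
    show "\<zero>\<^bsub>M\<^esub> \<in> \<Inter>?\<V>" using N.submodule_zero by blast
    show "x \<oplus>\<^bsub>M\<^esub> y \<in> \<Inter>?\<V>" if "x \<in> \<Inter>?\<V>" "y \<in> \<Inter>?\<V>" for x y
      using that N.submoduleE(5) by (simp del: Inter_iff add: Inter_iff)
    show "a \<odot>\<^bsub>M\<^esub> x \<in> \<Inter>?\<V>" if "a \<in> carrier (R\<lparr>carrier := K\<rparr>)" "x \<in> \<Inter>?\<V>" for a x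
      using that N.submoduleE(4) by simp
  qed
qed

lemma subspace_span_incl: "A \<subseteq> subspace_span K R M A"
  unfolding subspace_span_def by blast

lemma subspace_span_minimal:
  "submodule V (R\<lparr>carrier := K\<rparr>) M \<Longrightarrow> A \<subseteq> V \<Longrightarrow> subspace_span K R M A \<subseteq> V"
  unfolding subspace_span_def by blast

lemma subspace_span_mono: "A \<subseteq> B \<Longrightarrow> subspace_span K R M A \<subseteq> subspace_span K R M B"
  unfolding subspace_span_def by blast

text \<open>Preimages of \<open>K\<close>-subspaces under \<open>F\<close> are again subspaces
  because \<open>F (c x) = c^p F x\<close>. Hence \<open>F\<close> carries the span of
  \<open>F^i(M)\<close> into that of \<open>F^(i+1)(M)\<close>.\<close>

lemma stable_part_closed:
  assumes K: "subfield K R" and F: "frobenius_action p R M F" and y: "y \<in> stable_part K R M F"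
  shows "F y \<in> stable_part K R M F"
proof -
  note Fp = frobenius_action_funpow[OF F]
  note F1 = Fp[where e = 1, simplified]
  interpret N: module "R\<lparr>carrier := K\<rparr>" M by (rule module_restrict[OF K])
  have KR: "K \<subseteq> carrier R" by (rule subfieldE(3)[OF K])
  have Kpow: "c [^] (n::nat) \<in> K" if "c \<in> K" for c n
    using that subringE(3,6)[OF subfieldE(1)[OF K]] by (induction n) auto
  have img: "(F ^^ j) ` carrier M \<subseteq> carrier M" for j using Fp(1) by blast
  let ?W = "\<lambda>j. subspace_span K R M ((F ^^ j) ` carrier M)"
  note W = subspace_span_submodule[OF K img]
  note WE = N.submoduleE[OF W]
  have "F y \<in> ?W j" if j: "j \<ge> 1" for j
  proof -
    obtain i where i: "j = Suc i" using j by (cases j) auto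
    have "submodule {x \<in> carrier M. F x \<in> ?W j} (R\<lparr>carrier := K\<rparr>) M"
    proof (rule N.submoduleI')
      show "\<zero>\<^bsub>M\<^esub> \<in> {x \<in> carrier M. F x \<in> ?W j}" using N.submodule_zero[OF W] frobenius_action_funpow_zero[OF F, of 1] by simp
    qed (use WE(4,5) F1(2,3) KR Kpow in auto)
    moreover have "(F ^^ i) ` carrier M \<subseteq> {x \<in> carrier M. F x \<in> ?W j}"
      using subspace_span_incl[of "(F ^^ j) ` carrier M" K] Fp(1) unfolding i by auto
    ultimately have *: "?W i \<subseteq> {x \<in> carrier M. F x \<in> ?W j}" by (rule subspace_span_minimal)
    have "y \<in> ?W i"
    \<comment> \<open>The intersection starts at index 1, so for \<open>i = 0\<close> membership in
      the span of \<open>M\<close> itself comes from \<open>y\<close> lying in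
      \<open>carrier M\<close>.\<close>
    proof (cases "i = 0")
      case True
      have "y \<in> ?W 1" using y unfolding stable_part_def by blast
      then show ?thesis using WE(1)[of 1] subspace_span_incl[of "carrier M" K] True by auto
    next
      case False
      then show ?thesis using y unfolding stable_part_def by simp
    qed
    then show ?thesis using * by blast
  qed
  then show ?thesis unfolding stable_part_def by blast
qed

end

theorem theorem1p2:
  fixes R :: "('a, 'c) ring_scheme" and M :: "('a, 'b, 'd) module_scheme"
    and \<mm> K :: "'a set" and F :: "'b \<Rightarrow> 'b" and p :: nat
  assumes "noetherian_ring R" and "local_ring R \<mm>"
    and "Factorial_Ring.prime p" and "ring_characteristic R = p"
    and "coefficient_field K R \<mm>"
    and "artinian_module R M"
    and "frobenius_action p R M F" and "inj_on F (carrier M)"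
  shows "F_stable \<mm> M F \<longleftrightarrow> stable_part K R M F \<noteq> {\<zero>\<^bsub>M\<^esub>}"
proof -
  interpret noetherian_ring R by fact
  interpret local_ring R \<mm> by fact
  interpret I: maximalideal \<mm> R by (rule maximal)
  interpret M: module R M using assms(6) unfolding artinian_module_def by blast
  have K: "subfield K R" using assms(5) unfolding coefficient_field_def by blast
  have KR: "K \<subseteq> carrier R" by (rule subfieldE(3)[OF K])
  interpret N: module "R\<lparr>carrier := K\<rparr>" M by (rule M.module_restrict[OF K])
  have mR: "a \<in> carrier R" if "a \<in> \<mm>" for a using that I.a_subset by blast
  define S where "S = socle \<mm> M"
  have S_iff: "x \<in> S \<longleftrightarrow> x \<in> carrier M \<and> (\<forall>a\<in>\<mm>. a \<odot>\<^bsub>M\<^esub> x = \<zero>\<^bsub>M\<^esub>)" for x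
    unfolding S_def socle_def by blast
  note Fp = M.frobenius_action_funpow[OF assms(7)]
  note F_pow_zero = M.frobenius_action_funpow_zero[OF assms(7)]
  note F_pow_zeroD = M.frobenius_action_funpow_eq_zeroD[OF assms(7,8)]
  have S_sub: "submodule S (R\<lparr>carrier := K\<rparr>) M"
  proof (rule N.submoduleI')
    fix c x assume c: "c \<in> carrier (R\<lparr>carrier := K\<rparr>)" and x: "x \<in> S"
    have "a \<odot>\<^bsub>M\<^esub> (c \<odot>\<^bsub>M\<^esub> x) = \<zero>\<^bsub>M\<^esub>" if a: "a \<in> \<mm>" for a
    proof -
      have "a \<odot>\<^bsub>M\<^esub> (c \<odot>\<^bsub>M\<^esub> x) = c \<odot>\<^bsub>M\<^esub> (a \<odot>\<^bsub>M\<^esub> x)"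
        using M.smult_assoc1[of a c x] M.smult_assoc1[of c a x] m_comm[of a c] c KR mR[OF a] x
        unfolding S_iff by auto
      then show ?thesis using x a c KR unfolding S_iff by auto
    qed
    then show "c \<odot>\<^bsub>M\<^esub> x \<in> S" using c x KR unfolding S_iff by auto
  qed (use mR S_iff in \<open>auto simp: M.smult_r_distr\<close>)
  \<comment> \<open>Writing \<open>r = m + c\<close> with \<open>m\<close> in \<open>\<mm>\<close>
    and \<open>c\<close> in \<open>K\<close>, only \<open>c\<close> acts on the socle. So its
    \<open>K\<close>-subspaces are \<open>R\<close>-submodules, and the Artinian hypothesis yields a
    chain condition over \<open>K\<close>.\<close>
  have R_sub: "submodule V R M" if V: "submodule V (R\<lparr>carrier := K\<rparr>) M" "V \<subseteq> S" for V
  proof (rule M.submoduleI')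
    note VE = N.submoduleE[OF V(1), simplified]
    show "V \<subseteq> carrier M" "\<zero>\<^bsub>M\<^esub> \<in> V" using VE(1) N.submodule_zero[OF V(1)] by auto
    show "x \<oplus>\<^bsub>M\<^esub> y \<in> V" if "x \<in> V" "y \<in> V" for x y using VE(5) that by blast
    fix r x assume r: "r \<in> carrier R" and x: "x \<in> V"
    obtain c m where cm: "c \<in> K" "m \<in> \<mm>" "r = m \<oplus>\<^bsub>R\<^esub> c"
      using coefficient_field_decomp[OF assms(2,5) r] by blast
    have xS: "x \<in> S" "x \<in> carrier M" using x V(2) S_iff by blast+
    then have "r \<odot>\<^bsub>M\<^esub> x = c \<odot>\<^bsub>M\<^esub> x"
      using cm mR[OF cm(2)] KR S_iff by (auto simp: M.smult_l_distr)
    then show "r \<odot>\<^bsub>M\<^esub> x \<in> V" using VE(4)[OF cm(1) x] by simp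
  qed
  have dcc: "dcc_on (R\<lparr>carrier := K\<rparr>) M {} S"
    unfolding dcc_on_def
  proof (intro allI impI)
    fix V :: "nat \<Rightarrow> 'b set"
    assume V: "(\<forall>i. submodule (V i) (R\<lparr>carrier := K\<rparr>) M \<and> V i \<subseteq> S \<and> (\<forall>\<phi>\<in>{}. \<phi> ` V i \<subseteq> V i)) \<and>
      (\<forall>i. V (Suc i) \<subseteq> V i)"
    then have "\<forall>i. submodule (V i) R M" using R_sub by blast
    then show "\<exists>n. \<forall>i\<ge>n. V i = V n" using assms(6) V unfolding artinian_module_def by blast
  qed
  let ?Ms = "stable_part K R M F"
  have img: "(F ^^ j) ` carrier M \<subseteq> carrier M" for j using Fp(1) by blast
  have Ms_zero: "\<zero>\<^bsub>M\<^esub> \<in> ?Ms"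
    unfolding stable_part_def using N.submodule_zero[OF M.subspace_span_submodule[OF K img]] by blast
  show ?thesis
  proof
    assume ne: "?Ms \<noteq> {\<zero>\<^bsub>M\<^esub>}"
    obtain G where G: "G \<subseteq> carrier R" "finite G" "\<mm> = Idl\<^bsub>R\<^esub> G"
      using finetely_gen[OF I.is_ideal] by blast
    have Gm: "G \<subseteq> \<mm>" using G(3) genideal_self[OF G(1)] by simp
    \<comment> \<open>The annihilator of an element is an ideal, so being killed by finitely many
      generators suffices. This puts the socle in the form to which
      \<open>stable_part_subset\<close> applies.\<close>
    have S_eq: "S = {x \<in> carrier M. \<forall>a\<in>G. a \<odot>\<^bsub>M\<^esub> x = \<zero>\<^bsub>M\<^esub>}"
    proof (intro equalityI subsetI)
      fix x assume x: "x \<in> {x \<in> carrier M. \<forall>a\<in>G. a \<odot>\<^bsub>M\<^esub> x = \<zero>\<^bsub>M\<^esub>}"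
      have "ideal {a \<in> carrier R. a \<odot>\<^bsub>M\<^esub> x = \<zero>\<^bsub>M\<^esub>} R"
      proof (rule idealI)
        show "subgroup {a \<in> carrier R. a \<odot>\<^bsub>M\<^esub> x = \<zero>\<^bsub>M\<^esub>} (add_monoid R)"
          by (rule add.subgroupI)
            (use x in \<open>auto simp: M.smult_l_distr M.smult_l_minus a_inv_def[symmetric]\<close>)
        show "r \<otimes>\<^bsub>R\<^esub> a \<in> {a \<in> carrier R. a \<odot>\<^bsub>M\<^esub> x = \<zero>\<^bsub>M\<^esub>}" "a \<otimes>\<^bsub>R\<^esub> r \<in> {a \<in> carrier R. a \<odot>\<^bsub>M\<^esub> x = \<zero>\<^bsub>M\<^esub>}"
          if "a \<in> {a \<in> carrier R. a \<odot>\<^bsub>M\<^esub> x = \<zero>\<^bsub>M\<^esub>}" "r \<in> carrier R" for a r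
          using that x m_comm[of a r] by (auto simp: M.smult_assoc1)
      qed (rule ring_axioms)
      then have "\<mm> \<subseteq> {a \<in> carrier R. a \<odot>\<^bsub>M\<^esub> x = \<zero>\<^bsub>M\<^esub>}"
        unfolding G(3) by (rule genideal_minimal) (use x G(1) in blast)
      then show "x \<in> S" using x unfolding S_iff by blast
    qed (use Gm S_iff in blast)
    have "[p] \<cdot>\<^bsub>R\<^esub> \<one>\<^bsub>R\<^esub> = \<zero>\<^bsub>R\<^esub>"
      using add.pow_ord_eq_1[OF one_closed] assms(4) unfolding ring_characteristic_def by simp
    then have sub: "?Ms \<subseteq> S"
      unfolding S_eq
      using M.stable_part_subset[OF K assms(3) _ assms(7,8) G(2,1)] dcc[unfolded S_eq]
        artinian_locally_nilpotent[OF assms(1,2,6)] Gm by blast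
    obtain y where y: "y \<in> ?Ms" "y \<noteq> \<zero>\<^bsub>M\<^esub>" using ne Ms_zero by blast
    \<comment> \<open>Invariance keeps all iterates of \<open>y\<close> in \<open>?Ms\<close>, hence
      in the socle, and injectivity keeps them nonzero, so no \<open>e\<close> gives a trivial
      intersection.\<close>
    have F_pow_Ms: "(F ^^ e) y \<in> ?Ms" for e
      by (induction e) (simp_all add: y(1) M.stable_part_closed[OF K assms(7)])
    show "F_stable \<mm> M F"
      unfolding F_stable_def F_unstable_def S_def[symmetric]
    proof
      assume "\<exists>N>0. \<forall>e\<ge>N. S \<inter> (F ^^ e) ` S = {\<zero>\<^bsub>M\<^esub>}"
      then obtain e where "S \<inter> (F ^^ e) ` S = {\<zero>\<^bsub>M\<^esub>}" by blast
      then have "(F ^^ e) y = \<zero>\<^bsub>M\<^esub>" using sub F_pow_Ms y(1) by blast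
      then show False using F_pow_zeroD y sub S_iff by blast
    qed
  next
    assume st: "F_stable \<mm> M F"
    define E where "E e = {x \<in> S. \<forall>i\<le>e. (F ^^ i) x \<in> S}" for e
    note SE = N.submoduleE[OF S_sub, simplified]
    have Kpow: "c [^]\<^bsub>R\<^esub> (n::nat) \<in> K" if "c \<in> K" for c n
      using that subringE(3,6)[OF subfieldE(1)[OF K]] by (induction n) auto
    have E_sub: "submodule (E e) (R\<lparr>carrier := K\<rparr>) M" for e
    proof (rule N.submoduleI')
      show "E e \<subseteq> carrier M" using S_iff unfolding E_def by blast
      show "\<zero>\<^bsub>M\<^esub> \<in> E e" unfolding E_def using N.submodule_zero[OF S_sub] F_pow_zero by simp
      show "x \<oplus>\<^bsub>M\<^esub> y \<in> E e" if "x \<in> E e" "y \<in> E e" for x y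
        using that SE(5) Fp(2) S_iff unfolding E_def by simp
      show "c \<odot>\<^bsub>M\<^esub> x \<in> E e" if "c \<in> carrier (R\<lparr>carrier := K\<rparr>)" "x \<in> E e" for c x
        using that SE(4) Fp(3) S_iff Kpow KR unfolding E_def by (simp add: subset_iff)
    qed
    have "\<exists>n. \<forall>i\<ge>n. E i = E n"
      by (rule dcc_onD[OF dcc]) (use E_sub in \<open>auto simp: E_def\<close>)
    then obtain n where n: "\<And>i. i \<ge> n \<Longrightarrow> E i = E n" by blast
    have "\<exists>v\<in>E n. v \<noteq> \<zero>\<^bsub>M\<^esub>"
    proof -
      \<comment> \<open>The bound \<open>Suc n\<close> is positive, as the definition of instability
        demands, and it fails; this gives \<open>e > n\<close> for which some nonzero
        \<open>F^e v\<close> with \<open>v\<close> in the socle lies in the socle.\<close>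
      obtain e where e: "e \<ge> Suc n" "S \<inter> (F ^^ e) ` S \<noteq> {\<zero>\<^bsub>M\<^esub>}"
        using st unfolding F_stable_def F_unstable_def S_def[symmetric] by blast
      have "\<zero>\<^bsub>M\<^esub> \<in> S \<inter> (F ^^ e) ` S"
        using N.submodule_zero[OF S_sub] F_pow_zero[of e] by (metis IntI image_eqI)
      then obtain v where v: "v \<in> S" "(F ^^ e) v \<in> S" "(F ^^ e) v \<noteq> \<zero>\<^bsub>M\<^esub>" using e(2) by blast
      have vM: "v \<in> carrier M" using v(1) S_iff by blast
      \<comment> \<open>Intermediate iterates are in the socle too: \<open>F^(e - i)\<close> sends
        \<open>a F^i v\<close> to a positive power of \<open>a\<close> times \<open>F^e v\<close>,
        which is zero, and \<open>F\<close> is injective.\<close>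
      have "(F ^^ i) v \<in> S" if i: "i \<le> n" for i
        unfolding S_iff
      proof (intro conjI ballI)
        show iM: "(F ^^ i) v \<in> carrier M" using Fp(1)[OF vM] .
        fix a assume a: "a \<in> \<mm>"
        have aR: "a \<in> carrier R" using mR[OF a] .
        let ?q = "p ^ (e - i)"
        have "?q > 0" using prime_gt_0_nat[OF assms(3)] by simp
        then have "a [^]\<^bsub>R\<^esub> ?q = a [^]\<^bsub>R\<^esub> (?q - 1) \<otimes>\<^bsub>R\<^esub> a" using nat_pow_Suc[of a "?q - 1"] by simp
        then have q: "a [^]\<^bsub>R\<^esub> ?q \<in> \<mm>" using I.I_l_closed[OF a, of "a [^]\<^bsub>R\<^esub> (?q - 1)"] aR by simp
        have "(F ^^ (e - i)) (a \<odot>\<^bsub>M\<^esub> (F ^^ i) v) = (a [^]\<^bsub>R\<^esub> ?q) \<odot>\<^bsub>M\<^esub> (F ^^ (e - i)) ((F ^^ i) v)"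
          by (rule Fp(3)[OF aR iM])
        also have "(F ^^ (e - i)) ((F ^^ i) v) = (F ^^ e) v"
          using i e(1) by (metis comp_apply funpow_add le_add_diff_inverse2 le_SucI order_trans)
        finally have "(F ^^ (e - i)) (a \<odot>\<^bsub>M\<^esub> (F ^^ i) v) = \<zero>\<^bsub>M\<^esub>" using q v(2) S_iff by simp
        then show "a \<odot>\<^bsub>M\<^esub> (F ^^ i) v = \<zero>\<^bsub>M\<^esub>" using F_pow_zeroD aR iM by simp
      qed
      then show ?thesis using v F_pow_zero unfolding E_def by auto
    qed
    then obtain v where v: "v \<in> E n" "v \<noteq> \<zero>\<^bsub>M\<^esub>" by blast
    \<comment> \<open>Since \<open>E n = E (Suc n)\<close>, one more iterate is known to lie in the
      socle, and this gives invariance under \<open>F\<close>.\<close>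
    have E_F: "F x \<in> E n" if "x \<in> E n" for x
    proof -
      have x: "x \<in> E (Suc n)" using n[of "Suc n"] that by simp
      have "(F ^^ i) (F x) \<in> S" if "i \<le> n" for i
        using x that unfolding E_def by (simp add: funpow_swap1[symmetric] del: funpow.simps) (metis Suc_le_mono funpow.simps(2) o_apply)
      moreover from this[of 0] have "F x \<in> S" by simp
      ultimately show ?thesis unfolding E_def by blast
    qed
    have E_F_pow: "(F ^^ j) x \<in> E n" if "x \<in> E n" for x j
      using that by (induction j) (simp_all add: E_F)
    have EM: "E n \<subseteq> carrier M" using N.submoduleE(1)[OF E_sub] .
    \<comment> \<open>The image of a subspace under the semilinear \<open>F^j\<close> need not be a
      subspace, hence the spans. They stay in \<open>E n\<close>, so the chain condition of the
      socle applies.\<close>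
    define W where "W j = subspace_span K R M ((F ^^ j) ` E n)" for j
    have W_sub: "submodule (W j) (R\<lparr>carrier := K\<rparr>) M" for j
      unfolding W_def by (rule M.subspace_span_submodule[OF K]) (use E_F_pow EM in blast)
    have "\<exists>k. \<forall>i\<ge>k. W i = W k"
    proof (rule dcc_onD[OF dcc])
      show "W i \<subseteq> S" for i
      proof -
        have "W i \<subseteq> E n" unfolding W_def by (rule M.subspace_span_minimal[OF E_sub]) (use E_F_pow in blast)
        then show ?thesis unfolding E_def by blast
      qed
      show "W (Suc i) \<subseteq> W i" for i
        unfolding W_def
      proof (rule M.subspace_span_mono, rule image_subsetI)
        fix x assume "x \<in> E n"
        then show "(F ^^ Suc i) x \<in> (F ^^ i) ` E n" using E_F by (simp add: funpow_swap1)
      qed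
    qed (use W_sub in auto)
    then obtain k where k: "\<And>i. i \<ge> k \<Longrightarrow> W i = W k" by blast
    \<comment> \<open>For each \<open>j\<close> the stable value \<open>W k\<close> equals
      \<open>W (max j k)\<close>, which lies in the span of \<open>F^j(M)\<close>.\<close>
    have "(F ^^ k) v \<in> ?Ms"
      unfolding stable_part_def
    proof
      fix j :: nat assume "j \<in> {1..}"
      have "(F ^^ k) v \<in> W k" unfolding W_def using M.subspace_span_incl v(1) by blast
      then have "(F ^^ k) v \<in> W (max j k)" using k[of "max j k"] by simp
      moreover have "(F ^^ max j k) x \<in> (F ^^ j) ` carrier M" if "x \<in> E n" for x
      proof -
        have "(F ^^ max j k) x = (F ^^ j) ((F ^^ (max j k - j)) x)"
          by (metis comp_apply funpow_add le_add_diff_inverse max.cobounded1)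
        then show ?thesis using E_F_pow[OF that] EM by blast
      qed
      then have "W (max j k) \<subseteq> subspace_span K R M ((F ^^ j) ` carrier M)"
        unfolding W_def by (intro M.subspace_span_mono) blast
      ultimately show "(F ^^ k) v \<in> subspace_span K R M ((F ^^ j) ` carrier M)" by blast
    qed
    moreover have "(F ^^ k) v \<noteq> \<zero>\<^bsub>M\<^esub>" using F_pow_zeroD v EM by blast
    ultimately show "?Ms \<noteq> {\<zero>\<^bsub>M\<^esub>}" by blast
  qed
qed

end
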